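(* Let $P=x^2y+z(zt^2+1)\in\mathbb{C}[x,y,z,t]$ and let $X\subset\mathbb{A}^4=\mathrm{Spec}(\mathbb{C}[x,y,z,t])$ be the smooth hypersurface defined by $P=0$. Let $\varphi$ be an automorphism of $\mathbb{C}[x,z,t]$ with $\varphi(x)=x$ and $\varphi\equiv\overline{\varphi}$ modulo $(x^2)$, where $\overline{\varphi}=\exp(x\,\mathrm{Jac}(zt^2,\cdot))$, and let $\tilde{\varphi}$ be the $\mathbb{C}[x]$-automorphism of the coordinate ring $\mathbb{C}[X]$ lifting $\varphi$ (see the context). Then the automorphism of $X$ determined by $\tilde{\varphi}$ cannot extend to an automorphism of the ambient space $\mathbb{A}^4$; that is, there is no $\mathbb{C}$-algebra automorphism $\Phi$ of $\mathbb{C}[x,y,z,t]$ which preserves the ideal $(P)$ and induces $\tilde{\varphi}$ on $\mathbb{C}[X]=\mathbb{C}[x,y,z,t]/(P)$.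
   Context: For $f,g\in\mathbb{C}[z,t]$, $\mathrm{Jac}(f,g)=f_zg_t-f_tg_z$ (subscripts denote partial derivatives), and $\mathrm{Jac}(f,\cdot)$ is the derivation $g\mapsto\mathrm{Jac}(f,g)$, extended $\mathbb{C}[x]$-linearly. Let $r_0=z(zt^2+1)$ and $h=zt^2$. The $\mathbb{C}[x]/(x^2)$-automorphism $\overline{\varphi}=\exp(x\,\mathrm{Jac}(h,\cdot))$ of $\mathbb{C}[x]/(x^2)[z,t]$ is given by $\overline{\varphi}(z)=(1-2tx)z$ and $\overline{\varphi}(t)=(1+tx)t$. It has Jacobian determinant $1$ and hence, by a known theorem of van den Essen, Maubach and Vénéreau, lifts to a $\mathbb{C}[x]$-automorphism $\varphi$ of $\mathbb{C}[x,z,t]$, i.e. there exists an automorphism $\varphi$ of $\mathbb{C}[x,z,t]$ with $\varphi(x)=x$ and $\varphi\equiv\overline{\varphi}$ modulo $(x^2)$. One has $\overline{\varphi}(r_0)=(1-2xt)r_0$, so $\varphi$ preserves the ideals $(x)$ and $(x^2,r_0)$ of $\mathbb{C}[x,z,t]$. Regarding $\mathbb{C}[x,z,t]\subset\mathbb{C}[X]\subset\mathbb{C}[x,x^{-1},z,t]$ with $y=-x^{-2}r_0$, the automorphism $\varphi$ therefore lifts uniquely to an automorphism $\tilde{\varphi}$ of $\mathbb{C}[X]$ restricting to $\varphi$ on $\mathbb{C}[x,z,t]$. *)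

theory Defs
  imports
    "HOL-Computational_Algebra.Polynomial"
    "Jordan_Normal_Form.Matrix"
begin

(* Jordan_Normal_Form.Matrix is imported only because it provides the ring homomorphism
   locales (comm_ring_hom) of Polynomial_Interpolation.Ring_Hom. *)

text \<open>
  \<open>C[x,z,t]\<close> is represented as \<open>C[x][z][t]\<close> (the outermost variable is \<open>t\<close>) and
  \<open>C[x,y,z,t]\<close> as \<open>C[x,z,t][y]\<close>.
\<close>

type_synonym xzt_poly = "complex poly poly poly"
type_synonym xyzt_poly = "xzt_poly poly"

definition vx :: xzt_poly where "vx = [:[:[:0, 1:]:]:]"
definition vz :: xzt_poly where "vz = [:[:0, 1:]:]"
definition vt :: xzt_poly where "vt = [:0, 1:]"

definition vy :: xyzt_poly where "vy = [:0, 1:]"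

definition const3 :: "complex \<Rightarrow> xzt_poly" where "const3 c = [:[:[:c:]:]:]"

definition incl :: "xzt_poly \<Rightarrow> xyzt_poly" where "incl f = [:f:]"

definition alg_automorphism :: "('k \<Rightarrow> 'a) \<Rightarrow> ('a::comm_ring_1 \<Rightarrow> 'a) \<Rightarrow> bool" where
  \<comment> \<open>\<open>\<eta>\<close> is the structure map from the ring of scalars into the algebra.\<close>
  "alg_automorphism \<eta> \<phi> \<longleftrightarrow> comm_ring_hom \<phi> \<and> bij \<phi> \<and> (\<forall>c. \<phi> (\<eta> c) = \<eta> c)"

definition d_z :: "xzt_poly \<Rightarrow> xzt_poly" where "d_z = map_poly pderiv"
definition d_t :: "xzt_poly \<Rightarrow> xzt_poly" where "d_t = pderiv"

text \<open>Both derivations kill \<open>C[x]\<close>, so \<open>Jac f\<close> is already the \<open>C[x]\<close>-linear extension.\<close>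

definition Jac :: "xzt_poly \<Rightarrow> xzt_poly \<Rightarrow> xzt_poly" where
  "Jac f g = d_z f * d_t g - d_t f * d_z g"

definition poly_h :: xzt_poly where "poly_h = vz * vt\<^sup>2"

definition poly_r0 :: xzt_poly where "poly_r0 = vz * (vz * vt\<^sup>2 + 1)"

definition poly_P :: xyzt_poly where "poly_P = (incl vx)\<^sup>2 * vy + incl poly_r0"

text \<open>
  \<open>cong_exp m D \<phi>\<close> says \<open>\<phi> \<equiv> exp D\<close> modulo the ideal \<open>(m)\<close>, for an operator \<open>D\<close> that is locally
  nilpotent modulo \<open>(m)\<close>: for each \<open>f\<close> the exponential series is then a finite sum modulo \<open>(m)\<close>,
  whose value is the eventual value of its partial sums.
\<close>

definition cong_exp :: "xzt_poly \<Rightarrow> (xzt_poly \<Rightarrow> xzt_poly) \<Rightarrow> (xzt_poly \<Rightarrow> xzt_poly) \<Rightarrow> bool" where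
  "cong_exp m D \<phi> \<longleftrightarrow>
     (\<forall>f. \<forall>\<^sub>F N in sequentially. m dvd \<phi> f - (\<Sum>n<N. const3 (1 / fact n) * (D ^^ n) f))"

quotient_type coord_ring = xyzt_poly / "\<lambda>f g. poly_P dvd f - g"
  morphisms rep_X proj_X
proof (rule equivpI)
  show "reflp (\<lambda>f g. poly_P dvd f - g)" by (simp add: reflp_def)
  show "symp (\<lambda>f g. poly_P dvd f - g)"
  proof (rule sympI)
    fix a b assume "poly_P dvd a - b"
    then have "poly_P dvd - (a - b)" by (simp only: dvd_minus_iff)
    then show "poly_P dvd b - a" by simp
  qed
  show "transp (\<lambda>f g. poly_P dvd f - g)"
  proof (rule transpI)
    fix a b c assume "poly_P dvd a - b" "poly_P dvd b - c"
    then have "poly_P dvd (a - b) + (b - c)" by (rule dvd_add)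
    then show "poly_P dvd a - c" by simp
  qed
qed

text \<open>\<open>coord_ring\<close> is \<open>C[X] = C[x,y,z,t]/(P)\<close>; \<open>proj_X \<circ> incl\<close> is the inclusion of \<open>C[x,z,t]\<close>.\<close>

lemma poly_P_not_dvd_1: "\<not> poly_P dvd 1"
proof
  have poly_P_eq: "poly_P = [:poly_r0, vx\<^sup>2:]"
    by (simp add: poly_P_def incl_def vy_def power2_eq_square)
  have "vx\<^sup>2 \<noteq> 0" by (simp add: vx_def)
  then have "degree poly_P = 1" by (simp add: poly_P_eq)
  moreover assume "poly_P dvd 1"
  then have "degree poly_P \<le> degree (1 :: xyzt_poly)" by (rule dvd_imp_degree_le) simp
  ultimately show False by simp
qed

instantiation coord_ring :: comm_ring_1
begin

lift_definition zero_coord_ring :: coord_ring is 0 .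
lift_definition one_coord_ring :: coord_ring is 1 .
lift_definition plus_coord_ring :: "coord_ring \<Rightarrow> coord_ring \<Rightarrow> coord_ring" is "(+)"
proof -
  fix a b c d :: xyzt_poly
  assume "poly_P dvd a - b" "poly_P dvd c - d"
  then have "poly_P dvd (a - b) + (c - d)" by (rule dvd_add)
  then show "poly_P dvd a + c - (b + d)" by (simp add: algebra_simps)
qed

lift_definition uminus_coord_ring :: "coord_ring \<Rightarrow> coord_ring" is uminus
proof -
  fix a b :: xyzt_poly
  assume "poly_P dvd a - b"
  then have "poly_P dvd - (a - b)" by (simp only: dvd_minus_iff)
  then show "poly_P dvd - a - - b" by simp
qed

lift_definition minus_coord_ring :: "coord_ring \<Rightarrow> coord_ring \<Rightarrow> coord_ring" is "(-)"
proof -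
  fix a b c d :: xyzt_poly
  assume "poly_P dvd a - b" "poly_P dvd c - d"
  then have "poly_P dvd (a - b) - (c - d)" by (rule dvd_diff)
  then show "poly_P dvd a - c - (b - d)" by (simp add: algebra_simps)
qed

lift_definition times_coord_ring :: "coord_ring \<Rightarrow> coord_ring \<Rightarrow> coord_ring" is "(*)"
proof -
  fix a b c d :: xyzt_poly
  assume "poly_P dvd a - b" "poly_P dvd c - d"
  moreover have "a * c - b * d = (a - b) * c + b * (c - d)" by (simp add: algebra_simps)
  ultimately show "poly_P dvd a * c - b * d" by simp
qed

instance
  by standard (transfer; simp add: algebra_simps poly_P_not_dvd_1; fail)+

end

definition scalar_X :: "complex poly \<Rightarrow> coord_ring" where
  \<comment> \<open>the structure map of \<open>C[X]\<close> as a \<open>C[x]\<close>-algebra\<close>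
  "scalar_X p = proj_X (incl [:[:p:]:])"

end

theory Submission
  imports
    Defs
    "HOL-Complex_Analysis.Great_Picard"
    "HOL-Computational_Algebra.Fundamental_Theorem_Algebra"
    "HOL-Computational_Algebra.Polynomial_Factorial"
begin

text \<open>
  The extension \<open>\<Phi>\<close> would have to move all the threefolds \<open>P = v\<close> at once, and this is impossible
  because the curve \<open>r_0 = v\<close> is irreducible for \<open>v \<noteq> 0\<close> but has two components for \<open>v = 0\<close>. The
  polynomial \<open>h = z t^2\<close> generates the given automorphism to first order in \<open>x\<close>. On \<open>r_0 = 0\<close> it is
  locally constant but not constant: it is \<open>0\<close> on \<open>z = 0\<close> and \<open>-1\<close> on \<open>z t^2 = -1\<close>. An extension to
  the neighbouring fibres would give a family of generating functions that are constant on the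
  irreducible curves \<open>r_0 = v\<close>, and the limit at \<open>v = 0\<close> would be constant on \<open>r_0 = 0\<close>.

  To compare fibres in this way, \<open>\<Phi>\<close> must respect the projection to \<open>x\<close> and the affine space with
  coordinates \<open>x, z, t, v = P\<close>, that is, the subring \<open>C[x,z,t,P]\<close>. This is the global part of the
  argument (\<open>flow_curve_invariant_in_xztP\<close>, \<open>generators_in_xztP\<close>). The images of \<open>x, z, t\<close> under \<open>\<Phi>\<close>
  are invariants of algebraic flows that preserve \<open>P\<close>. The torus action \<open>(e x, y / e^2, z, t)\<close> degenerates
  an invariant outside \<open>C[x,z,t,P]\<close> to one that is divisible by \<open>y\<close>, and the flow lines to polynomial
  curves along which \<open>y\<close> and \<open>P\<close> are constant. The surfaces with constant \<open>y\<close> and \<open>P\<close> are essentially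
  the cubics \<open>u - v + t u v = t\<close>, and a comparison of degrees shows that they contain no nonconstant
  polynomial curves through general points. So \<open>\<Phi>\<close> preserves \<open>C[x,z,t,P]\<close>. Its
  elements \<open>a\<close> such that \<open>a^n y\<close> is again in the subring for some \<open>n\<close> are divisible by \<open>x\<close>. This
  applies to \<open>\<Phi> x\<close>, and likewise to the preimage of \<open>x\<close>, so \<open>\<Phi> x\<close> is a scalar multiple of \<open>x\<close>, and it equals \<open>x\<close> because it does so modulo \<open>P\<close>.

  On \<open>C[x,z,t,v]\<close> the restriction of \<open>\<Phi>\<close> has constant Jacobian determinant in \<open>z\<close> and \<open>t\<close>, so its part
  of first order in \<open>x\<close> comes from a generating function \<open>H\<close> (\<open>hamiltonian\<close>). Since \<open>\<Phi> (x^2 y)\<close> is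
  divisible by \<open>x^2\<close>, the function \<open>H\<close> is constant along \<open>r_0 = v\<close> (\<open>hamiltonian_equal_at_ends\<close>), while
  at \<open>x = v = 0\<close> it equals \<open>- z t^2\<close> up to a constant.
\<close>

section \<open>Polynomials in four variables and their values\<close>

abbreviation const4 :: "complex \<Rightarrow> xyzt_poly" where "const4 c \<equiv> incl (const3 c)"
abbreviation X4 :: xyzt_poly where "X4 \<equiv> incl vx"
abbreviation Z4 :: xyzt_poly where "Z4 \<equiv> incl vz"
abbreviation T4 :: xyzt_poly where "T4 \<equiv> incl vt"

lemma poly_induct_generators:
  fixes p :: "'a::comm_ring_1 poly"
  assumes "\<And>c. Q [:c:]" "Q [:0, 1:]"
    and "\<And>p q. Q p \<Longrightarrow> Q q \<Longrightarrow> Q (p + q)" "\<And>p q. Q p \<Longrightarrow> Q q \<Longrightarrow> Q (p * q)"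
  shows "Q p"
proof (induction p)
  case 0
  show ?case using assms(1)[of 0] by simp
next
  case (pCons a p)
  have "pCons a p = [:a:] + [:0, 1:] * p" by simp
  then show ?case using assms pCons.IH by metis
qed

lemma xyzt_induct [case_names const x y z t add mult]:
  fixes f :: xyzt_poly
  assumes const: "\<And>c. Q (const4 c)" and x: "Q X4" and y: "Q vy" and z: "Q Z4" and t: "Q T4"
    and add: "\<And>f g. Q f \<Longrightarrow> Q g \<Longrightarrow> Q (f + g)" and mult: "\<And>f g. Q f \<Longrightarrow> Q g \<Longrightarrow> Q (f * g)"
  shows "Q f"
proof (rule poly_induct_generators[of Q])
  have hom: "[:a + b:] = [:a:] + [:b:]" "[:a * b:] = [:a:] * [:b:]" for a b :: "'b::comm_ring_1"
    by simp_all
  have 1: "Q [:[:[:a:]:]:]" for a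
    by (rule poly_induct_generators[of "\<lambda>a. Q [:[:[:a:]:]:]"])
      (use const x add mult in \<open>simp_all only: hom incl_def const3_def vx_def\<close>)
  have 2: "Q [:[:a:]:]" for a
    by (rule poly_induct_generators[of "\<lambda>a. Q [:[:a:]:]"])
      (use 1 z add mult in \<open>simp_all only: hom incl_def vz_def\<close>)
  show "Q [:a:]" for a
    by (rule poly_induct_generators[of "\<lambda>a. Q [:a:]"])
      (use 2 t add mult in \<open>simp_all only: hom incl_def vt_def\<close>)
  show "Q [:0, 1:]" using y by (simp add: vy_def)
qed (use add mult in auto)

definition ev :: "xyzt_poly \<Rightarrow> complex \<Rightarrow> complex \<Rightarrow> complex \<Rightarrow> complex \<Rightarrow> complex" where
  "ev f x y z t = poly (poly (poly (poly f [:[:[:y:]:]:]) [:[:t:]:]) [:z:]) x"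

lemma ev_simps [simp]:
  "ev (const4 c) x y z t = c" "ev X4 x y z t = x" "ev vy x y z t = y"
  "ev Z4 x y z t = z" "ev T4 x y z t = t" "ev 0 x y z t = 0" "ev 1 x y z t = 1"
  "ev (f + g) x y z t = ev f x y z t + ev g x y z t"
  "ev (f - g) x y z t = ev f x y z t - ev g x y z t"
  "ev (- f) x y z t = - ev f x y z t"
  "ev (f * g) x y z t = ev f x y z t * ev g x y z t"
  "ev (f ^ n) x y z t = ev f x y z t ^ n"
  by (simp_all add: ev_def incl_def const3_def vx_def vy_def vz_def vt_def)

lemma ev_numeral [simp]: "ev (numeral n) x y z t = numeral n"
  by (simp add: ev_def)

lemma ev_sum: "ev (sum g S) x y z t = (\<Sum>m\<in>S. ev (g m) x y z t)"
  by (simp add: ev_def poly_sum)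

lemma incl_hom [simp]:
  "incl (f + g) = incl f + incl g" "incl (f - g) = incl f - incl g" "incl (f * g) = incl f * incl g"
  "incl (f ^ n) = incl f ^ n" "incl 1 = 1" "incl 0 = 0" "incl (- f) = - incl f"
  by (simp_all add: incl_def one_pCons poly_const_pow)

lemma incl_r0: "incl poly_r0 = Z4 * (Z4 * T4\<^sup>2 + 1)"
  by (simp add: poly_r0_def)

lemma ev_P [simp]: "ev poly_P x y z t = x\<^sup>2 * y + z * (z * t\<^sup>2 + 1)"
  by (simp add: poly_P_def incl_r0)

text \<open>
A homomorphism of \<open>C\<close>-algebras is composition with the polynomial map of \<open>C^4\<close> whose
coordinates are the images of the variables. This turns statements about automorphisms into
statements about points and curves.
\<close>

lemma ev_alg_hom:
  assumes "comm_ring_hom \<Phi>" "\<And>c. \<Phi> (const4 c) = const4 c"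
  shows "ev (\<Phi> f) x y z t =
    ev f (ev (\<Phi> X4) x y z t) (ev (\<Phi> vy) x y z t) (ev (\<Phi> Z4) x y z t) (ev (\<Phi> T4) x y z t)"
proof -
  interpret comm_ring_hom \<Phi> by fact
  show ?thesis
    by (induction f rule: xyzt_induct) (simp_all add: assms(2) hom_add hom_mult)
qed

lemma exists_nonroot:
  fixes k :: "complex \<Rightarrow> 'a::idom"
  assumes "inj k" "p \<noteq> 0"
  shows "\<exists>c. poly p (k c) \<noteq> 0"
proof (rule ccontr)
  assume "\<not> ?thesis"
  then have "range k \<subseteq> {a. poly p a = 0}" by auto
  then have "finite (range k)" using poly_roots_finite[OF assms(2)] finite_subset by blast
  then show False using assms(1) finite_imageD infinite_UNIV_char_0 by blast
qed

lemma ev_nonzero: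
  assumes "f \<noteq> 0"
  shows "\<exists>x y z t. ev f x y z t \<noteq> 0"
proof -
  obtain y where y: "poly f [:[:[:y:]:]:] \<noteq> 0"
    using exists_nonroot[of "\<lambda>y. [:[:[:y:]:]:]" f] assms by (auto simp: inj_def)
  obtain t where t: "poly (poly f [:[:[:y:]:]:]) [:[:t:]:] \<noteq> 0"
    using exists_nonroot[of "\<lambda>y. [:[:y:]:]", OF _ y] by (auto simp: inj_def)
  obtain z where z: "poly (poly (poly f [:[:[:y:]:]:]) [:[:t:]:]) [:z:] \<noteq> 0"
    using exists_nonroot[of "\<lambda>y. [:y:]", OF _ t] by (auto simp: inj_def)
  obtain x where "ev f x y z t \<noteq> 0"
    using exists_nonroot[of "\<lambda>y. y", OF _ z] by (auto simp: inj_def ev_def)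
  then show ?thesis by blast
qed

fun mono4 :: "complex \<Rightarrow> nat \<times> nat \<times> nat \<times> nat \<Rightarrow> xyzt_poly" where
  "mono4 c (i, j, k, l) = monom (monom (monom (monom c i) k) l) j"

fun coeff4 :: "xyzt_poly \<Rightarrow> nat \<times> nat \<times> nat \<times> nat \<Rightarrow> complex" where
  "coeff4 f (i, j, k, l) = coeff (coeff (coeff (coeff f j) l) k) i"

definition supp4 :: "xyzt_poly \<Rightarrow> (nat \<times> nat \<times> nat \<times> nat) set" where
  "supp4 f = {m. coeff4 f m \<noteq> 0}"

lemma ev_mono4: "ev (mono4 c (i, j, k, l)) x y z t = c * x ^ i * y ^ j * z ^ k * t ^ l"
  by (simp add: ev_def poly_monom poly_const_pow mult_ac)

lemma coeff4_mono4: "coeff4 (mono4 c m) m' = (if m = m' then c else 0)"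
  by (cases m; cases m') (auto)

lemma coeff4_sum: "coeff4 (sum g S) m = (\<Sum>s\<in>S. coeff4 (g s) m)"
  by (cases m) (simp add: coeff_sum)

lemma coeff4_eqI: "(\<And>m. coeff4 f m = coeff4 g m) \<Longrightarrow> f = g"
  by (intro poly_eqI) (metis coeff4.simps)

lemma finite_supp4: "finite (supp4 f)"
proof -
  have fin: "finite {n. coeff p n \<noteq> 0}" for p :: "'b::zero poly"
    by (rule finite_subset[of _ "{..degree p}"]) (auto intro: le_degree)
  let ?B = "SIGMA j:{j. coeff f j \<noteq> 0}. SIGMA l:{l. coeff (coeff f j) l \<noteq> 0}.
    SIGMA k:{k. coeff (coeff (coeff f j) l) k \<noteq> 0}. {i. coeff (coeff (coeff (coeff f j) l) k) i \<noteq> 0}"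
  have "finite ?B" by (intro finite_SigmaI fin)
  moreover have "supp4 f \<subseteq> (\<lambda>(j, l, k, i). (i, j, k, l)) ` ?B"
  proof
    fix m assume "m \<in> supp4 f"
    moreover obtain i j k l where m: "m = (i, j, k, l)" by (cases m)
    ultimately have "(j, l, k, i) \<in> ?B" by (auto simp: supp4_def)
    then show "m \<in> (\<lambda>(j, l, k, i). (i, j, k, l)) ` ?B" using m by force
  qed
  ultimately show ?thesis using finite_surj by blast
qed

lemma sum_mono4_coeff4: "(\<Sum>m\<in>supp4 f. mono4 (coeff4 f m) m) = f"
  by (rule coeff4_eqI) (simp add: coeff4_sum coeff4_mono4 finite_supp4, auto simp: supp4_def)

text \<open>
Since \<open>x^2 y = P - r_0\<close>, divisibility of the \<open>j\<close>-th coefficient in \<open>y\<close> by \<open>x^(2 j)\<close> describes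
the subring \<open>C[x,z,t,P]\<close>; see \<open>in_xztP_subst_P\<close> and \<open>in_xztP_imp_subst_P\<close> below.
\<close>

definition in_xztP :: "xyzt_poly \<Rightarrow> bool" where
  "in_xztP f \<longleftrightarrow> (\<forall>j. vx ^ (2 * j) dvd coeff f j)"

lemma vx_power_dvd_iff:
  "vx ^ n dvd g \<longleftrightarrow> (\<forall>l k i. i < n \<longrightarrow> coeff (coeff (coeff g l) k) i = 0)"
proof -
  have "vx ^ n = [:[:monom 1 n:]:]"
    by (simp add: vx_def poly_const_pow monom_altdef)
  then show ?thesis
    by (simp add: const_poly_dvd_iff monom_1_dvd_iff')
qed

text \<open>
The action \<open>(x, y, z, t) \<mapsto> (e x, y / e^2, z, t)\<close> of the multiplicative group, which leaves \<open>P\<close>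
invariant, multiplies a monomial of weight \<open>n\<close> by the power of \<open>e\<close> with exponent \<open>-n\<close>.
\<close>

fun weight :: "nat \<times> nat \<times> nat \<times> nat \<Rightarrow> int" where
  "weight (i, j, k, l) = 2 * int j - int i"

lemma in_xztP_iff_weight: "in_xztP f \<longleftrightarrow> (\<forall>m\<in>supp4 f. weight m \<le> 0)"
  by (auto simp: in_xztP_def vx_power_dvd_iff supp4_def) (metis not_le of_nat_less_iff of_nat_mult of_nat_numeral)+

text \<open>
Here \<open>g\<close> is the component of highest weight \<open>d\<close> of \<open>f\<close>, and \<open>F\<close> is the family of rescalings of
\<open>f\<close> that degenerates to \<open>g\<close> as \<open>e\<close> tends to \<open>0\<close>. If \<open>f\<close> is outside \<open>C[x,z,t,P]\<close>, then \<open>d\<close> is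
positive; every monomial of positive weight contains \<open>y\<close>, so \<open>g\<close> vanishes on \<open>y = 0\<close>.
\<close>

lemma dilation_expansion:
  assumes "f \<noteq> 0"
  obtains d :: int and F :: "complex \<Rightarrow> complex \<Rightarrow> complex \<Rightarrow> complex \<Rightarrow> complex \<Rightarrow> complex" and g
  where "g \<noteq> 0"
    and "\<And>e x y z t. e \<noteq> 0 \<Longrightarrow> ev f (e * x) (y / e\<^sup>2) z t = e powi (- d) * F e x y z t"
    and "\<And>x y z t. F 0 x y z t = ev g x y z t"
    and "\<And>e x y z t e' x' y' z' t'. e \<longlonglongrightarrow> e' \<Longrightarrow> x \<longlonglongrightarrow> x' \<Longrightarrow> y \<longlonglongrightarrow> y' \<Longrightarrow> z \<longlonglongrightarrow> z' \<Longrightarrow> t \<longlonglongrightarrow> t' \<Longrightarrow>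
          (\<lambda>n. F (e n) (x n) (y n) (z n) (t n)) \<longlonglongrightarrow> F e' x' y' z' t'"
    and "\<not> in_xztP f \<Longrightarrow> d > 0 \<and> (\<forall>x z t. ev g x 0 z t = 0)"
proof -
  have S0: "supp4 f \<noteq> {}" using assms sum_mono4_coeff4[of f] by auto
  define d where "d = Max (weight ` supp4 f)"
  have d: "weight m \<le> d" if "m \<in> supp4 f" for m
    using that finite_supp4[of f] by (simp add: d_def)
  have "d \<in> weight ` supp4 f" unfolding d_def
    by (rule Max_in) (use finite_supp4[of f] S0 in auto)
  then obtain m0 where m0: "m0 \<in> supp4 f" "weight m0 = d" by auto
  define F where "F e x y z t = (\<Sum>m\<in>supp4 f. e ^ nat (d - weight m) * ev (mono4 (coeff4 f m) m) x y z t)"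
    for e x y z t :: complex
  define g where "g = (\<Sum>m\<in>supp4 f. if weight m = d then mono4 (coeff4 f m) m else 0)"
  have cg: "coeff4 g m = (if weight m = d then coeff4 f m else 0)" for m
  proof -
    have [simp]: "coeff4 0 m = 0" by (cases m) simp
    have "coeff4 g m = (\<Sum>s\<in>supp4 f. if s = m then (if weight m = d then coeff4 f m else 0) else 0)"
      unfolding g_def coeff4_sum by (intro sum.cong) (auto simp: coeff4_mono4)
    then show ?thesis using finite_supp4[of f] by (auto simp: supp4_def)
  qed
  show thesis
  proof (rule that[of g d F])
    show "g \<noteq> 0"
    proof
      assume "g = 0"
      then have "coeff4 g m0 = 0" by (cases m0) simp
      then show False using m0 by (simp add: cg supp4_def)
    qed
    show "F 0 x y z t = ev g x y z t" for x y z t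
      unfolding F_def g_def ev_sum by (intro sum.cong) (auto simp: power_0_left dest!: d)
    show "(\<lambda>n. F (e n) (x n) (y n) (z n) (t n)) \<longlonglongrightarrow> F e' x' y' z' t'"
      if "e \<longlonglongrightarrow> e'" "x \<longlonglongrightarrow> x'" "y \<longlonglongrightarrow> y'" "z \<longlonglongrightarrow> z'" "t \<longlonglongrightarrow> t'" for e x y z t e' x' y' z' t'
    proof -
      have "(\<lambda>n. ev (mono4 c m) (x n) (y n) (z n) (t n)) \<longlonglongrightarrow> ev (mono4 c m) x' y' z' t'" for c m
        by (cases m) (simp only: ev_mono4, intro tendsto_intros that)
      then show ?thesis unfolding F_def by (intro tendsto_intros that)
    qed
    show "ev f (e * x) (y / e\<^sup>2) z t = e powi (- d) * F e x y z t" if "e \<noteq> 0" for e x y z t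
    proof -
      have "ev f (e * x) (y / e\<^sup>2) z t = (\<Sum>m\<in>supp4 f. ev (mono4 (coeff4 f m) m) (e * x) (y / e\<^sup>2) z t)"
        by (subst sum_mono4_coeff4[of f, symmetric]) (simp only: ev_sum)
      also have "\<dots> = (\<Sum>m\<in>supp4 f. e powi (- d) * (e ^ nat (d - weight m) * ev (mono4 (coeff4 f m) m) x y z t))"
      proof (intro sum.cong refl)
        fix m assume m: "m \<in> supp4 f"
        obtain i j k l where ijkl: "m = (i, j, k, l)" by (cases m)
        have "e powi (- d) * e ^ nat (d - weight m) = e powi (- d) * e powi (d - weight m)"
          using d[OF m] by (simp add: power_int_def)
        also have "\<dots> = e powi (int i - 2 * int j)"
          using that by (simp add: power_int_add[symmetric] ijkl)
        also have "\<dots> = e ^ i / (e\<^sup>2) ^ j"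
          using that by (simp add: power_int_diff power_int_mult)
        finally have "e powi (- d) * e ^ nat (d - weight m) = e ^ i / (e\<^sup>2) ^ j" .
        then show "ev (mono4 (coeff4 f m) m) (e * x) (y / e\<^sup>2) z t =
            e powi (- d) * (e ^ nat (d - weight m) * ev (mono4 (coeff4 f m) m) x y z t)"
          unfolding mult.assoc[symmetric]
          by (simp add: ijkl ev_mono4 power_mult_distrib power_divide del: mono4.simps)
      qed
      finally show ?thesis by (simp add: F_def sum_distrib_left)
    qed
    show "d > 0 \<and> (\<forall>x z t. ev g x 0 z t = 0)" if "\<not> in_xztP f"
    proof
      show "d > 0" using that d by (fastforce simp: in_xztP_iff_weight)
      then show "\<forall>x z t. ev g x 0 z t = 0"
        unfolding g_def ev_sum by (auto simp: ev_mono4 simp del: mono4.simps intro!: sum.neutral)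
    qed
  qed
qed

section \<open>Polynomial curves along which P is constant\<close>

text \<open>
The inequality is the condition on the starting point of a curve that excludes the exceptional
lines \<open>u = const\<close> with \<open>2 s t u = 1\<close> in the next lemma; it does not involve \<open>s\<close> and
so serves both square roots of \<open>-1\<close>.
\<close>

lemma conic_side_condition:
  fixes r x y z t u :: complex
  assumes "(2 * z * t\<^sup>2 + 1)\<^sup>2 + 4 * y * x\<^sup>2 * t\<^sup>2 \<noteq> 0" "r\<^sup>2 = y" "s\<^sup>2 = -1"
    and "u = r * x + s * z * t"
  shows "1 - 2 * s * t * u \<noteq> 0"
proof
  assume "1 - 2 * s * t * u = 0"
  moreover have "2 * s * t * u = 2 * s * t * r * x + s\<^sup>2 * (2 * z * t\<^sup>2)"
    by (simp add: assms(4) power2_eq_square algebra_simps)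
  ultimately have "1 + 2 * z * t\<^sup>2 = 2 * s * t * r * x"
    using assms(3) by (simp add: algebra_simps)
  then have "(1 + 2 * z * t\<^sup>2)\<^sup>2 = (2 * s * t * r * x)\<^sup>2" by simp
  also have "\<dots> = s\<^sup>2 * (4 * r\<^sup>2 * x\<^sup>2 * t\<^sup>2)" by (simp add: power_mult_distrib)
  also have "\<dots> = - (4 * y * x\<^sup>2 * t\<^sup>2)" using assms(2,3) by simp
  finally show False using assms(1) by (simp add: algebra_simps)
qed

text \<open>
Comparing degrees in \<open>u - v = 2 s t (l - u v)\<close>: if \<open>u v\<close> is not constant, the right-hand side has
degree \<open>deg t + deg u + deg v\<close> and the left-hand side at most the larger of \<open>deg u\<close> and \<open>deg v\<close>.
Hence \<open>t\<close> and one of \<open>u\<close>, \<open>v\<close> are constant, and then the equation is linear in the other one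
with a nonzero coefficient.
\<close>

lemma no_affine_lines_on_cubic:
  fixes u v t :: "complex poly"
  assumes uv: "u - v = Polynomial.smult (2 * s) (t * (Polynomial.smult l 1 - u * v))" and s: "s\<^sup>2 = -1"
    and t: "t \<noteq> 0" and z: "Polynomial.smult l 1 - u * v \<noteq> 0" and u: "u \<noteq> 0" and v: "v \<noteq> 0"
    and cu: "1 - 2 * s * poly t 0 * poly u 0 \<noteq> 0" and cv: "1 + 2 * s * poly t 0 * poly v 0 \<noteq> 0"
  shows "degree u = 0 \<and> degree v = 0"
proof (rule ccontr)
  assume "\<not> ?thesis"
  then have pos: "degree u + degree v > 0" by auto
  have s0: "s \<noteq> 0" using s by auto
  have duv: "degree (u * v) = degree u + degree v" using u v by (rule degree_mult_eq)
  have "degree (Polynomial.smult l 1 - u * v) = degree (u * v)"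
    using degree_add_eq_left[of "Polynomial.smult l 1" "- (u * v)"] pos duv by simp
  moreover have "degree (u - v) = degree t + degree (Polynomial.smult l 1 - u * v)"
    using uv s0 t z by (simp add: degree_mult_eq)
  moreover have "degree (u - v) \<le> max (degree u) (degree v)" by (rule degree_diff_le_max)
  ultimately have "degree t + degree u + degree v \<le> max (degree u) (degree v)"
    using duv by simp
  then have dt: "degree t = 0" and d: "degree u = 0 \<or> degree v = 0" by auto
  obtain t0 where t0: "t = [:t0:]" using dt by (rule degree_eq_zeroE)
  show False
  proof (cases "degree v = 0")
    case True
    then obtain v0 where v0: "v = [:v0:]" by (rule degree_eq_zeroE)
    have "Polynomial.smult (1 + 2 * s * t0 * v0) u = [:v0 + 2 * s * t0 * l:]"
      using uv by (simp add: t0 v0 smult_diff_right smult_add_left algebra_simps)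
    then have "degree (Polynomial.smult (1 + 2 * s * t0 * v0) u) = 0" by simp
    then show False using cv t0 v0 pos True by simp
  next
    case False
    then have "degree u = 0" using d by simp
    then obtain u0 where u0: "u = [:u0:]" by (rule degree_eq_zeroE)
    have exchange: "a - b = c - d \<Longrightarrow> b - d = a - c" for a b c d :: "complex poly"
      by (simp add: algebra_simps)
    have "[:u0:] - v = [:2 * s * t0 * l:] - Polynomial.smult (2 * s * t0 * u0) v"
      using uv by (simp add: t0 u0 smult_diff_right algebra_simps)
    then have "v - Polynomial.smult (2 * s * t0 * u0) v = [:u0:] - [:2 * s * t0 * l:]"
      using exchange by blast
    then have "Polynomial.smult (1 - 2 * s * t0 * u0) v = [:u0 - 2 * s * t0 * l:]"
      by (simp add: smult_diff_left)
    then have "degree (Polynomial.smult (1 - 2 * s * t0 * u0) v) = 0" by simp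
    then show False using cu t0 u0 False by simp
  qed
qed

text \<open>
For constant \<open>y\<close> and \<open>l\<close>, the surface \<open>x^2 y + z^2 t^2 + z = l\<close> carries no nonconstant polynomial
curve through a general point. With \<open>u\<close> and \<open>v\<close> the two linear factors of \<open>y x^2 + (z t)^2\<close>, it becomes
\<open>u v = l - z\<close>, \<open>u - v = 2 \<i> z t\<close>; up to scaling this is the cubic surface
\<open>u - v = t (l - u v)\<close>, the equation of the preceding lemma.
\<close>

lemma conic_curve_constant:
  fixes X Z T :: "complex poly"
  assumes eq: "Polynomial.smult y (X\<^sup>2) + Z\<^sup>2 * T\<^sup>2 + Z = [:l:]" and y: "y \<noteq> 0"
    and z0: "poly Z 0 \<noteq> 0" and t0: "poly T 0 \<noteq> 0"
    and uv0: "(poly X 0)\<^sup>2 * y + (poly Z 0)\<^sup>2 * (poly T 0)\<^sup>2 \<noteq> 0"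
    and c0: "(2 * poly Z 0 * (poly T 0)\<^sup>2 + 1)\<^sup>2 + 4 * y * (poly X 0)\<^sup>2 * (poly T 0)\<^sup>2 \<noteq> 0"
  shows "degree X = 0 \<and> degree Z = 0 \<and> degree T = 0"
proof -
  define r where "r = csqrt y"
  have r: "r\<^sup>2 = y" "r \<noteq> 0" using y by (auto simp: r_def)
  define u where "u = Polynomial.smult r X + Polynomial.smult \<i> (Z * T)"
  define v where "v = Polynomial.smult r X - Polynomial.smult \<i> (Z * T)"
  have uv: "u * v = Polynomial.smult y (X\<^sup>2) + Z\<^sup>2 * T\<^sup>2"
    by (simp add: u_def v_def algebra_simps power2_eq_square r(1)[symmetric])
  have Z: "Z = Polynomial.smult l 1 - u * v"
    using eq unfolding uv by (simp add: algebra_simps)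
  have nz: "Z \<noteq> 0" "T \<noteq> 0" using z0 t0 by auto
  have "poly (u * v) 0 \<noteq> 0" unfolding uv using uv0 by (simp add: mult_ac)
  then have "u \<noteq> 0" "v \<noteq> 0" by auto
  have diff: "u - v = Polynomial.smult (2 * \<i>) (T * Z)"
    by (simp add: u_def v_def mult_ac smult_add_left[symmetric])
  have deg: "degree u = 0 \<and> degree v = 0"
  proof (rule no_affine_lines_on_cubic)
    show "u - v = Polynomial.smult (2 * \<i>) (T * (Polynomial.smult l 1 - u * v))" using diff Z by simp
    show "\<i>\<^sup>2 = -1" by simp
    show "T \<noteq> 0" "u \<noteq> 0" "v \<noteq> 0" by fact+
    show "Polynomial.smult l 1 - u * v \<noteq> 0" using nz(1) Z by simp
    show "1 - 2 * \<i> * poly T 0 * poly u 0 \<noteq> 0"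
      by (rule conic_side_condition[OF c0 r(1)]) (simp_all add: u_def)
    have "1 - 2 * (- \<i>) * poly T 0 * poly v 0 \<noteq> 0"
      by (rule conic_side_condition[OF c0 r(1)]) (simp_all add: v_def)
    then show "1 + 2 * \<i> * poly T 0 * poly v 0 \<noteq> 0" by simp
  qed
  have "degree (u - v) = 0" "degree (u + v) = 0"
    using deg degree_diff_le_max[of u v] degree_add_le_max[of u v] by auto
  moreover have "degree (u - v) = degree T + degree Z"
    using nz unfolding diff by (simp add: degree_mult_eq)
  moreover have "u + v = Polynomial.smult (2 * r) X"
    by (simp add: u_def v_def numeral_poly mult.commute)
  ultimately show ?thesis using r(2) by auto
qed

lemma exists_normalizing_scale:
  fixes a :: "nat \<Rightarrow> real"
  assumes nonneg: "\<And>m. a m \<ge> 0" and pos: "a k > 0" "k \<in> {1..N}"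
  shows "\<exists>r>0. (\<Sum>m=1..N. a m * r ^ m) = 1"
proof -
  define f where "f r = (\<Sum>m=1..N. a m * r ^ m)" for r
  define R where "R = max 1 (1 / a k)"
  have "1 \<le> a k * R" using pos by (simp add: R_def max_def field_simps)
  also have "\<dots> \<le> a k * R ^ k"
    using pos by (intro mult_left_mono self_le_power) (auto simp: R_def)
  also have "\<dots> \<le> f R" unfolding f_def
    by (rule member_le_sum[where f = "\<lambda>m. a m * R ^ m"]) (use pos nonneg in \<open>auto simp: R_def\<close>)
  finally have "1 \<le> f R" .
  moreover have f0: "f 0 = 0" by (simp add: f_def power_0_left)
  moreover have "continuous_on {0..R} f" unfolding f_def by (intro continuous_intros)
  moreover have "0 \<le> R" by (simp add: R_def)
  ultimately obtain r where "0 \<le> r" "f r = 1" using IVT'[of f 0 1 R] by auto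
  moreover have "r \<noteq> 0" using f0 \<open>f r = 1\<close> by auto
  ultimately show ?thesis unfolding f_def by (intro exI[of _ r]) auto
qed

lemma poly_eq_sum_atMost:
  fixes p :: "complex poly"
  assumes "degree p \<le> N"
  shows "poly p s = (\<Sum>m\<le>N. coeff p m * s ^ m)"
proof -
  have "(\<Sum>m\<le>N. coeff p m * s ^ m) = (\<Sum>m\<le>degree p. coeff p m * s ^ m)"
    by (rule sum.mono_neutral_right) (use assms in \<open>auto simp: coeff_eq_0\<close>)
  then show ?thesis by (simp add: Polynomial.poly_altdef)
qed

text \<open>
A sequence of nonconstant polynomial curves of bounded degree from a common starting point has,
after a linear change of parameter for each curve, a subsequence that converges to a nonconstant
polynomial curve: the parameter is scaled so that the absolute values of the higher coefficients
add up to \<open>1\<close>, and this normalization survives in the limit.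
\<close>

lemma normalized_curves_limit:
  fixes c :: "nat \<Rightarrow> nat \<Rightarrow> complex poly" and q :: "nat \<Rightarrow> complex"
  assumes deg: "\<And>n i. i \<in> I \<Longrightarrow> degree (c n i) \<le> N" and I: "finite I"
    and start: "\<And>n i. i \<in> I \<Longrightarrow> poly (c n i) 0 = q i"
    and nonconst: "\<And>n. \<exists>i\<in>I. degree (c n i) > 0"
  obtains \<rho> :: "nat \<Rightarrow> complex" and \<sigma> :: "nat \<Rightarrow> nat" and l :: "nat \<Rightarrow> complex poly"
  where "strict_mono \<sigma>" and "\<And>i s. i \<in> I \<Longrightarrow> (\<lambda>n. poly (c (\<sigma> n) i) (\<rho> (\<sigma> n) * s)) \<longlonglongrightarrow> poly (l i) s"
    and "\<And>i. i \<in> I \<Longrightarrow> poly (l i) 0 = q i" and "\<exists>i\<in>I. degree (l i) > 0"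
proof -
  have "\<exists>r>0. (\<Sum>m=1..N. (\<Sum>i\<in>I. norm (coeff (c n i) m)) * r ^ m) = 1" for n
  proof -
    obtain i where i: "i \<in> I" "degree (c n i) > 0" using nonconst by blast
    let ?k = "degree (c n i)"
    have "0 < norm (coeff (c n i) ?k)" using i by auto
    also have "\<dots> \<le> (\<Sum>i\<in>I. norm (coeff (c n i) ?k))"
      by (rule member_le_sum) (use I i in auto)
    finally show ?thesis
      by (intro exists_normalizing_scale[where k = ?k]) (use i deg[of i n] in \<open>auto intro: sum_nonneg\<close>)
  qed
  then obtain r where r: "\<And>n. r n > 0" "\<And>n. (\<Sum>m=1..N. (\<Sum>i\<in>I. norm (coeff (c n i) m)) * r n ^ m) = 1"
    by metis
  define b where "b n p = coeff (c n (fst p)) (snd p) * of_real (r n) ^ snd p" for n p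
  have bsum: "(\<Sum>m=1..N. \<Sum>i\<in>I. norm (b n (i, m))) = 1" for n
    unfolding r(2)[of n, symmetric] using r(1)[of n]
    by (simp add: b_def norm_mult norm_power sum_distrib_right)
  have b0: "b n (i, 0) = q i" if "i \<in> I" for n i
    using start[OF that, of n] by (simp add: b_def poly_0_coeff_0)
  have bound: "norm (b n p) \<le> 1 + (\<Sum>i\<in>I. norm (q i))" if p_in: "p \<in> I \<times> {..N}" for n p
  proof -
    obtain i m where p: "p = (i, m)" "i \<in> I" "m \<le> N" using p_in by (cases p) auto
    have q: "norm (q i) \<le> (\<Sum>i\<in>I. norm (q i))" by (rule member_le_sum) (use I p in auto)
    show ?thesis
    proof (cases "m = 0")
      case True then show ?thesis using q b0[OF p(2)] p by simp
    next
      case False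
      have "norm (b n (i, m)) \<le> (\<Sum>i\<in>I. norm (b n (i, m)))" by (rule member_le_sum) (use I p in auto)
      also have "\<dots> \<le> (\<Sum>m=1..N. \<Sum>i\<in>I. norm (b n (i, m)))"
        by (rule member_le_sum[where f = "\<lambda>m. \<Sum>i\<in>I. norm (b n (i, m))"])
          (use False p in \<open>auto intro: sum_nonneg\<close>)
      finally have "norm (b n p) \<le> 1" using bsum p by simp
      then show ?thesis using q norm_ge_zero[of "q i"] by linarith
    qed
  qed
  have "countable (I \<times> {..N})" using I by (simp add: countable_finite)
  then obtain \<sigma> where \<sigma>: "strict_mono \<sigma>" "\<And>p. p \<in> I \<times> {..N} \<Longrightarrow> \<exists>l. (\<lambda>n. b (\<sigma> n) p) \<longlonglongrightarrow> l"
    using function_convergent_subsequence[of "I \<times> {..N}" b, OF _ bound] by blast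
  then obtain \<beta> where \<beta>: "\<And>p. p \<in> I \<times> {..N} \<Longrightarrow> (\<lambda>n. b (\<sigma> n) p) \<longlonglongrightarrow> \<beta> p" by metis
  define l where "l i = (\<Sum>m\<le>N. monom (\<beta> (i, m)) m)" for i
  have cl: "coeff (l i) m = \<beta> (i, m)" if "m \<le> N" for i m
    using that by (simp add: l_def coeff_sum)
  show thesis
  proof (rule that[where \<sigma> = \<sigma> and l = l and \<rho> = "\<lambda>n. of_real (r n)"])
    show "strict_mono \<sigma>" by fact
    fix i assume i: "i \<in> I"
    show "(\<lambda>n. poly (c (\<sigma> n) i) (of_real (r (\<sigma> n)) * s)) \<longlonglongrightarrow> poly (l i) s" for s
    proof -
      have "poly (c n i) (of_real (r n) * s) = (\<Sum>m\<le>N. b n (i, m) * s ^ m)" for n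
        using poly_eq_sum_atMost[OF deg[OF i, of n]] by (simp add: b_def power_mult_distrib mult_ac)
      moreover have "poly (l i) s = (\<Sum>m\<le>N. \<beta> (i, m) * s ^ m)"
        by (simp add: l_def poly_sum poly_monom)
      moreover have "(\<lambda>n. \<Sum>m\<le>N. b (\<sigma> n) (i, m) * s ^ m) \<longlonglongrightarrow> (\<Sum>m\<le>N. \<beta> (i, m) * s ^ m)"
        by (intro tendsto_intros \<beta>) (use i in auto)
      ultimately show ?thesis by simp
    qed
    have "(\<lambda>n. b (\<sigma> n) (i, 0)) \<longlonglongrightarrow> \<beta> (i, 0)" using \<beta> i by auto
    then have "(\<lambda>n. q i) \<longlonglongrightarrow> \<beta> (i, 0)" by (simp add: b0[OF i])
    then have "\<beta> (i, 0) = q i" by (simp add: LIMSEQ_const_iff)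
    then show "poly (l i) 0 = q i" by (simp add: poly_0_coeff_0 cl)
  next
    have "(\<lambda>n. \<Sum>m=1..N. \<Sum>i\<in>I. norm (b (\<sigma> n) (i, m))) \<longlonglongrightarrow> (\<Sum>m=1..N. \<Sum>i\<in>I. norm (\<beta> (i, m)))"
      by (intro tendsto_intros \<beta>) auto
    then have "(\<Sum>m=1..N. \<Sum>i\<in>I. norm (\<beta> (i, m))) = 1"
      unfolding bsum by (simp only: LIMSEQ_const_iff)
    then have "(\<Sum>m=1..N. \<Sum>i\<in>I. norm (\<beta> (i, m))) \<noteq> 0" by simp
    then obtain m where m: "m \<in> {1..N}" "(\<Sum>i\<in>I. norm (\<beta> (i, m))) \<noteq> 0"
      by (rule sum.not_neutral_contains_not_neutral)
    from m(2) obtain i where "i \<in> I" "norm (\<beta> (i, m)) \<noteq> 0"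
      by (rule sum.not_neutral_contains_not_neutral)
    then have "i \<in> I" "coeff (l i) m \<noteq> 0" using m cl by auto
    then show "\<exists>i\<in>I. degree (l i) > 0" using le_degree[of "l i" m] m by (auto intro!: bexI[of _ i])
  qed
qed

lemma nowhere_zero_poly_constant:
  fixes p :: "complex poly"
  assumes "\<And>s. poly p s \<noteq> 0"
  shows "degree p = 0"
  using assms fundamental_theorem_of_algebra[of p] constant_degree[of p] by blast

text \<open>
Suppose that \<open>f\<close> is not in \<open>C[x,z,t,P]\<close>, and start the curves at the
points \<open>(e x, y / e^2, z, t)\<close>. Undo the dilation and let \<open>e\<close> tend to \<open>0\<close>: the limit is a
nonconstant polynomial curve through \<open>(x, y, z, t)\<close> on which \<open>P\<close> and the component of highest
weight of \<open>f\<close> are constant. That component vanishes on \<open>y = 0\<close>, so if its constant value is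
nonzero, the polynomial \<open>y\<close> has no zero on the curve and is itself constant there. This contradicts
\<open>conic_curve_constant\<close>. The polynomial \<open>g\<close> ensures that general curves are not constant.
\<close>

lemma flow_curve_invariant_in_xztP:
  fixes f g :: xyzt_poly
  assumes "g \<noteq> 0"
    and curves: "\<And>x y z t. \<exists>cx cy cz ct :: complex poly.
      degree cx \<le> N \<and> degree cy \<le> N \<and> degree cz \<le> N \<and> degree ct \<le> N \<and>
      poly cx 0 = x \<and> poly cy 0 = y \<and> poly cz 0 = z \<and> poly ct 0 = t \<and>
      (\<forall>s. ev f (poly cx s) (poly cy s) (poly cz s) (poly ct s) = ev f x y z t) \<and>
      (\<forall>s. ev poly_P (poly cx s) (poly cy s) (poly cz s) (poly ct s) = ev poly_P x y z t) \<and>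
      (ev g x y z t \<noteq> 0 \<longrightarrow> degree cx > 0 \<or> degree cy > 0 \<or> degree cz > 0 \<or> degree ct > 0)"
  shows "in_xztP f"
proof (rule ccontr)
  assume notin: "\<not> in_xztP f"
  then have "f \<noteq> 0" by (auto simp: in_xztP_def)
  obtain d F f' where f': "f' \<noteq> 0"
    and F: "\<And>e x y z t. e \<noteq> 0 \<Longrightarrow> ev f (e * x) (y / e\<^sup>2) z t = e powi (- d) * F e x y z t"
    and F0: "\<And>x y z t. F 0 x y z t = ev f' x y z t"
    and Flim: "\<And>e x y z t e' x' y' z' t'. e \<longlonglongrightarrow> e' \<Longrightarrow> x \<longlonglongrightarrow> x' \<Longrightarrow> y \<longlonglongrightarrow> y' \<Longrightarrow> z \<longlonglongrightarrow> z' \<Longrightarrow> t \<longlonglongrightarrow> t' \<Longrightarrow>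
          (\<lambda>n. F (e n) (x n) (y n) (z n) (t n)) \<longlonglongrightarrow> F e' x' y' z' t'"
    and top: "\<not> in_xztP f \<Longrightarrow> d > 0 \<and> (\<forall>x z t. ev f' x 0 z t = 0)"
    by (rule dilation_expansion[OF \<open>f \<noteq> 0\<close>]) (rule that, assumption+)
  obtain dg G g' where g': "g' \<noteq> 0"
    and G: "\<And>e x y z t. e \<noteq> 0 \<Longrightarrow> ev g (e * x) (y / e\<^sup>2) z t = e powi (- dg) * G e x y z t"
    and G0: "\<And>x y z t. G 0 x y z t = ev g' x y z t"
    and Glim: "\<And>e x y z t e' x' y' z' t'. e \<longlonglongrightarrow> e' \<Longrightarrow> x \<longlonglongrightarrow> x' \<Longrightarrow> y \<longlonglongrightarrow> y' \<Longrightarrow> z \<longlonglongrightarrow> z' \<Longrightarrow> t \<longlonglongrightarrow> t' \<Longrightarrow>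
          (\<lambda>n. G (e n) (x n) (y n) (z n) (t n)) \<longlonglongrightarrow> G e' x' y' z' t'"
    by (rule dilation_expansion[OF \<open>g \<noteq> 0\<close>]) (rule that, assumption+)
  \<comment> \<open>The factors of \<open>Q\<close> are the genericity conditions of \<open>conic_curve_constant\<close>.\<close>
  define Q :: xyzt_poly where "Q = vy * Z4 * T4 * (X4\<^sup>2 * vy + Z4\<^sup>2 * T4\<^sup>2) *
    ((2 * Z4 * T4\<^sup>2 + 1)\<^sup>2 + 4 * vy * X4\<^sup>2 * T4\<^sup>2)"
  have "ev Q 1 1 1 1 \<noteq> 0" by (simp add: Q_def)
  then have "Q \<noteq> 0" by auto
  then have "f' * g' * Q \<noteq> 0" using f' g' by simp
  then obtain x y z t where "ev (f' * g' * Q) x y z t \<noteq> 0" using ev_nonzero by blast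
  then have f'p: "ev f' x y z t \<noteq> 0" and g'p: "ev g' x y z t \<noteq> 0" and Qp: "ev Q x y z t \<noteq> 0"
    by simp_all
  define e0 :: "nat \<Rightarrow> complex" where "e0 = (\<lambda>n. of_real (inverse (real (Suc n))))"
  have e0: "e0 \<longlonglongrightarrow> 0" "\<And>n. e0 n \<noteq> 0"
    using LIMSEQ_inverse_real_of_nat[THEN tendsto_of_real[where 'a = complex]]
    by (simp_all add: e0_def del: of_nat_Suc)
  have "(\<lambda>n. G (e0 n) x y z t) \<longlonglongrightarrow> ev g' x y z t"
    unfolding G0[symmetric] by (intro Glim e0(1) tendsto_const)
  then have "eventually (\<lambda>n. G (e0 n) x y z t \<noteq> 0) sequentially"
    using g'p by (rule tendsto_imp_eventually_ne)
  then obtain M where M: "\<And>n. n \<ge> M \<Longrightarrow> G (e0 n) x y z t \<noteq> 0"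
    by (auto simp: eventually_sequentially)
  define e where "e = (\<lambda>n. e0 (n + M))"
  have e: "e \<longlonglongrightarrow> 0" "\<And>n. e n \<noteq> 0" "\<And>n. ev g (e n * x) (y / (e n)\<^sup>2) z t \<noteq> 0"
    using e0 M LIMSEQ_ignore_initial_segment[of e0 0 M] by (simp_all add: e_def G)
  define good where "good n c \<longleftrightarrow> (\<forall>i\<in>{..3}. degree (c i) \<le> N) \<and>
      poly (c 0) 0 = x \<and> poly (c 1) 0 = y \<and> poly (c 2) 0 = z \<and> poly (c 3) 0 = t \<and>
      (\<forall>s. F (e n) (poly (c 0) s) (poly (c 1) s) (poly (c 2) s) (poly (c 3) s) = F (e n) x y z t) \<and>
      (\<forall>s. ev poly_P (poly (c 0) s) (poly (c 1) s) (poly (c 2) s) (poly (c 3) s) = ev poly_P x y z t) \<and>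
      (\<exists>i\<in>{..3}. degree (c i) > 0)" for n and c :: "nat \<Rightarrow> complex poly"
  have "\<exists>c. good n c" for n
  proof -
    obtain cx cy cz ct where deg: "degree cx \<le> N" "degree cy \<le> N" "degree cz \<le> N" "degree ct \<le> N"
      and start: "poly cx 0 = e n * x" "poly cy 0 = y / (e n)\<^sup>2" "poly cz 0 = z" "poly ct 0 = t"
      and fs: "\<And>s. ev f (poly cx s) (poly cy s) (poly cz s) (poly ct s) = ev f (e n * x) (y / (e n)\<^sup>2) z t"
      and Ps: "\<And>s. ev poly_P (poly cx s) (poly cy s) (poly cz s) (poly ct s)
          = ev poly_P (e n * x) (y / (e n)\<^sup>2) z t"
      and nc: "degree cx > 0 \<or> degree cy > 0 \<or> degree cz > 0 \<or> degree ct > 0"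
      using curves[of "e n * x" "y / (e n)\<^sup>2" z t] e(3)[of n] by blast
    define c where "c = (\<lambda>i::nat. if i = 0 then Polynomial.smult (1 / e n) cx
      else if i = 1 then Polynomial.smult ((e n)\<^sup>2) cy else if i = 2 then cz else ct)"
    have c: "c 0 = Polynomial.smult (1 / e n) cx" "c 1 = Polynomial.smult ((e n)\<^sup>2) cy" "c 2 = cz" "c 3 = ct"
      by (simp_all add: c_def)
    have four: "{..3::nat} = {0, 1, 2, 3}" by auto
    have scale: "e n * poly (c 0) s = poly cx s" "poly (c 1) s / (e n)\<^sup>2 = poly cy s" for s
      using e(2)[of n] unfolding c by simp_all
    show ?thesis
    proof (unfold good_def, intro exI[of _ c] conjI allI)
      show "\<forall>i\<in>{..3}. degree (c i) \<le> N" unfolding four using deg e(2)[of n] by (simp add: c[simplified])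
      show "\<exists>i\<in>{..3}. degree (c i) > 0" unfolding four using nc e(2)[of n] by (simp add: c[simplified])
      show "poly (c 0) 0 = x" "poly (c 1) 0 = y" "poly (c 2) 0 = z" "poly (c 3) 0 = t"
        using start e(2)[of n] unfolding c by simp_all
      show "F (e n) (poly (c 0) s) (poly (c 1) s) (poly (c 2) s) (poly (c 3) s) = F (e n) x y z t" for s
      proof -
        have "e n powi (- d) * F (e n) (poly (c 0) s) (poly (c 1) s) (poly (c 2) s) (poly (c 3) s) =
            e n powi (- d) * F (e n) x y z t"
          unfolding F[OF e(2), symmetric] scale using fs by (simp add: c)
        then show ?thesis using e(2)[of n] by simp
      qed
      show "ev poly_P (poly (c 0) s) (poly (c 1) s) (poly (c 2) s) (poly (c 3) s) = ev poly_P x y z t" for s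
        using Ps[of s] e(2)[of n] unfolding scale[symmetric] by (simp add: c[simplified] power_divide power_mult_distrib)
    qed
  qed
  then obtain c where good: "\<And>n. good n (c n)" by metis
  then have c: "\<And>n i. i \<in> {..3} \<Longrightarrow> degree (c n i) \<le> N"
    "\<And>n. poly (c n 0) 0 = x" "\<And>n. poly (c n 1) 0 = y" "\<And>n. poly (c n 2) 0 = z" "\<And>n. poly (c n 3) 0 = t"
    and Fc: "\<And>n s. F (e n) (poly (c n 0) s) (poly (c n 1) s) (poly (c n 2) s) (poly (c n 3) s) = F (e n) x y z t"
    and Pc: "\<And>n s. ev poly_P (poly (c n 0) s) (poly (c n 1) s) (poly (c n 2) s) (poly (c n 3) s) = ev poly_P x y z t"
    and nc: "\<And>n. \<exists>i\<in>{..3}. degree (c n i) > 0"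
    unfolding good_def by blast+
  define p where "p = (\<lambda>i::nat. if i = 0 then x else if i = 1 then y else if i = 2 then z else t)"
  have start: "poly (c n i) 0 = p i" if "i \<in> {..3}" for n i
  proof -
    have "i = 0 \<or> i = 1 \<or> i = 2 \<or> i = 3" using that by auto
    then show ?thesis using c(2-5) by (auto simp: p_def)
  qed
  obtain \<rho> :: "nat \<Rightarrow> complex" and \<sigma> l where \<sigma>: "strict_mono \<sigma>"
    and lim: "\<And>i s. i \<in> {..3} \<Longrightarrow> (\<lambda>n. poly (c (\<sigma> n) i) (\<rho> (\<sigma> n) * s)) \<longlonglongrightarrow> poly (l i) s"
    and l0: "\<And>i. i \<in> {..3} \<Longrightarrow> poly (l i) 0 = p i" and lnc: "\<exists>i\<in>{..3}. degree (l i) > 0"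
    by (rule normalized_curves_limit[of "{..3}" c N p, OF c(1) finite_atMost start nc])
      (assumption+, rule that, assumption+)
  have lim': "(\<lambda>n. poly (c (\<sigma> n) 0) (\<rho> (\<sigma> n) * s)) \<longlonglongrightarrow> poly (l 0) s"
    "(\<lambda>n. poly (c (\<sigma> n) 1) (\<rho> (\<sigma> n) * s)) \<longlonglongrightarrow> poly (l 1) s"
    "(\<lambda>n. poly (c (\<sigma> n) 2) (\<rho> (\<sigma> n) * s)) \<longlonglongrightarrow> poly (l 2) s"
    "(\<lambda>n. poly (c (\<sigma> n) 3) (\<rho> (\<sigma> n) * s)) \<longlonglongrightarrow> poly (l 3) s" for s
    using lim by simp_all
  have start': "poly (l 0) 0 = x" "poly (l 1) 0 = y" "poly (l 2) 0 = z" "poly (l 3) 0 = t"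
    using l0 by (simp_all add: p_def)
  have e\<sigma>: "(\<lambda>n. e (\<sigma> n)) \<longlonglongrightarrow> 0" using e(1) \<sigma> LIMSEQ_subseq_LIMSEQ[of e 0 \<sigma>] by (simp add: o_def)
  have f'l: "ev f' (poly (l 0) s) (poly (l 1) s) (poly (l 2) s) (poly (l 3) s) = ev f' x y z t" for s
  proof -
    have "(\<lambda>n. F (e (\<sigma> n)) (poly (c (\<sigma> n) 0) (\<rho> (\<sigma> n) * s)) (poly (c (\<sigma> n) 1) (\<rho> (\<sigma> n) * s))
        (poly (c (\<sigma> n) 2) (\<rho> (\<sigma> n) * s)) (poly (c (\<sigma> n) 3) (\<rho> (\<sigma> n) * s)))
        \<longlonglongrightarrow> F 0 (poly (l 0) s) (poly (l 1) s) (poly (l 2) s) (poly (l 3) s)"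
      by (intro Flim e\<sigma> lim')
    then have "(\<lambda>n. F (e (\<sigma> n)) x y z t) \<longlonglongrightarrow> F 0 (poly (l 0) s) (poly (l 1) s) (poly (l 2) s) (poly (l 3) s)"
      by (simp only: Fc)
    moreover have "(\<lambda>n. F (e (\<sigma> n)) x y z t) \<longlonglongrightarrow> F 0 x y z t"
      by (intro Flim e\<sigma> tendsto_const)
    ultimately show ?thesis unfolding F0[symmetric] by (rule LIMSEQ_unique)
  qed
  have "degree (l 1) = 0"
  proof (rule nowhere_zero_poly_constant, rule notI)
    fix s assume "poly (l 1) s = 0"
    then have "ev f' (poly (l 0) s) 0 (poly (l 2) s) (poly (l 3) s) \<noteq> 0"
      using f'l[of s] f'p by simp
    then show False using top[OF notin] by simp
  qed
  then have l1: "l 1 = [:y:]" using start'(2) by (auto elim!: degree_eq_zeroE)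
  have Pl: "(poly (l 0) s)\<^sup>2 * y + poly (l 2) s * (poly (l 2) s * (poly (l 3) s)\<^sup>2 + 1) = ev poly_P x y z t" for s
  proof -
    have "(\<lambda>n. ev poly_P (poly (c (\<sigma> n) 0) (\<rho> (\<sigma> n) * s)) (poly (c (\<sigma> n) 1) (\<rho> (\<sigma> n) * s))
        (poly (c (\<sigma> n) 2) (\<rho> (\<sigma> n) * s)) (poly (c (\<sigma> n) 3) (\<rho> (\<sigma> n) * s)))
        \<longlonglongrightarrow> ev poly_P (poly (l 0) s) (poly (l 1) s) (poly (l 2) s) (poly (l 3) s)"
      unfolding ev_P by (intro tendsto_intros lim')
    then show ?thesis unfolding Pc by (simp add: LIMSEQ_const_iff l1[simplified])
  qed
  have "degree (l 0) = 0 \<and> degree (l 2) = 0 \<and> degree (l 3) = 0"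
  proof (rule conic_curve_constant)
    show "Polynomial.smult y ((l 0)\<^sup>2) + (l 2)\<^sup>2 * (l 3)\<^sup>2 + l 2 = [:ev poly_P x y z t:]"
      unfolding poly_eq_poly_eq_iff[symmetric]
      by (rule ext) (use Pl in \<open>simp add: algebra_simps power2_eq_square\<close>)
  qed (use Qp in \<open>simp_all add: Q_def start'\<close>)
  moreover have "i = 0 \<or> i = 1 \<or> i = 2 \<or> i = 3" if "i \<in> {..3}" for i :: nat using that by auto
  ultimately have "degree (l i) = 0" if "i \<in> {..3}" for i
    using that \<open>degree (l 1) = 0\<close> by metis
  then show False using lnc by simp
qed

section \<open>The subring generated by x, z, t and P\<close>

abbreviation complex_automorphism :: "(xyzt_poly \<Rightarrow> xyzt_poly) \<Rightarrow> bool" where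
  "complex_automorphism \<equiv> alg_automorphism (\<lambda>c. const4 c)"

lemma complex_automorphism_inv:
  assumes "complex_automorphism \<Phi>"
  shows "complex_automorphism (inv_into UNIV \<Phi>)" "inv_into UNIV \<Phi> (\<Phi> f) = f" "\<Phi> (inv_into UNIV \<Phi> f) = f"
proof -
  have hom: "comm_ring_hom \<Phi>" and bij: "bij \<Phi>" and const: "\<And>c. \<Phi> (const4 c) = const4 c"
    using assms by (auto simp: alg_automorphism_def)
  interpret comm_ring_hom \<Phi> by fact
  show 1: "inv_into UNIV \<Phi> (\<Phi> f) = f" and 2: "\<Phi> (inv_into UNIV \<Phi> f) = f" for f
    using bij by (simp_all add: bij_is_inj bij_is_surj surj_f_inv_f)
  have inj: "a = b" if "\<Phi> a = \<Phi> b" for a b using that bij by (metis bij_inv_eq_iff)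
  have "comm_ring_hom (inv_into UNIV \<Phi>)"
    by unfold_locales (rule inj, simp add: 2 hom_add hom_mult)+
  moreover have "inv_into UNIV \<Phi> (const4 c) = const4 c" for c by (rule inj) (simp add: 2 const)
  ultimately show "complex_automorphism (inv_into UNIV \<Phi>)"
    using bij by (simp add: alg_automorphism_def bij_imp_bij_inv)
qed

text \<open>
The degree bound \<open>N\<close> has to be uniform in the curve for the passage to a limit; the bound \<open>2\<close> is the degree of the flows used in
\<open>generators_in_xztP\<close>.
\<close>

lemma degree_ev_curve:
  "\<exists>N. \<forall>a b c d :: complex poly. degree a \<le> 2 \<longrightarrow> degree b \<le> 2 \<longrightarrow> degree c \<le> 2 \<longrightarrow> degree d \<le> 2 \<longrightarrow>
    (\<exists>q. degree q \<le> N \<and> (\<forall>s. poly q s = ev f (poly a s) (poly b s) (poly c s) (poly d s)))"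
  (is "\<exists>N. \<forall>a b c d. ?D a \<longrightarrow> ?D b \<longrightarrow> ?D c \<longrightarrow> ?D d \<longrightarrow> ?P f N a b c d")
proof (induction f rule: xyzt_induct)
  case (const k)
  have "?P (const4 k) 0 a b c d" for a b c d by (rule exI[of _ "[:k:]"]) simp
  then show ?case by blast
next
  case (add f g)
  then obtain M N where
    M: "\<And>a b c d. ?D a \<Longrightarrow> ?D b \<Longrightarrow> ?D c \<Longrightarrow> ?D d \<Longrightarrow> ?P f M a b c d" and
    N: "\<And>a b c d. ?D a \<Longrightarrow> ?D b \<Longrightarrow> ?D c \<Longrightarrow> ?D d \<Longrightarrow> ?P g N a b c d"
    by blast
  have "?P (f + g) (max M N) a b c d" if D: "?D a" "?D b" "?D c" "?D d" for a b c d
  proof -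
    obtain p q where "degree p \<le> M" "degree q \<le> N"
      "\<And>s. poly p s = ev f (poly a s) (poly b s) (poly c s) (poly d s)"
      "\<And>s. poly q s = ev g (poly a s) (poly b s) (poly c s) (poly d s)"
      using M[OF D] N[OF D] by blast
    then show ?thesis by (intro exI[of _ "p + q"]) (auto intro: degree_add_le)
  qed
  then show ?case by blast
next
  case (mult f g)
  then obtain M N where
    M: "\<And>a b c d. ?D a \<Longrightarrow> ?D b \<Longrightarrow> ?D c \<Longrightarrow> ?D d \<Longrightarrow> ?P f M a b c d" and
    N: "\<And>a b c d. ?D a \<Longrightarrow> ?D b \<Longrightarrow> ?D c \<Longrightarrow> ?D d \<Longrightarrow> ?P g N a b c d"
    by blast
  have "?P (f * g) (M + N) a b c d" if D: "?D a" "?D b" "?D c" "?D d" for a b c d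
  proof -
    obtain p q where "degree p \<le> M" "degree q \<le> N"
      "\<And>s. poly p s = ev f (poly a s) (poly b s) (poly c s) (poly d s)"
      "\<And>s. poly q s = ev g (poly a s) (poly b s) (poly c s) (poly d s)"
      using M[OF D] N[OF D] by blast
    then show ?thesis
      by (intro exI[of _ "p * q"]) (auto intro: order_trans[OF degree_mult_le] add_mono)
  qed
  then show ?case by blast
qed auto

text \<open>
The curves of the flow are carried through each point by the polynomial map of \<open>\<Phi>\<close>: to the point
\<open>q\<close> belongs the image under the map of the inverse of \<open>\<Phi>\<close> of the flow line through the image of
\<open>q\<close> under the map of \<open>\<Phi>\<close>. Along it \<open>\<Phi> h\<close> and \<open>P\<close> are constant.
\<close>

lemma flow_invariant_in_xztP:
  assumes \<Phi>: "complex_automorphism \<Phi>" and \<Phi>P: "\<Phi> poly_P = const4 \<kappa> * poly_P" "\<kappa> \<noteq> 0"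
    and flow: "\<And>x y z t. \<exists>a b c d :: complex poly. degree a \<le> 2 \<and> degree b \<le> 2 \<and> degree c \<le> 2 \<and> degree d \<le> 2 \<and>
      poly a 0 = x \<and> poly b 0 = y \<and> poly c 0 = z \<and> poly d 0 = t \<and>
      (\<forall>s. ev h (poly a s) (poly b s) (poly c s) (poly d s) = ev h x y z t) \<and>
      (\<forall>s. ev poly_P (poly a s) (poly b s) (poly c s) (poly d s) = ev poly_P x y z t) \<and>
      (x \<noteq> 0 \<longrightarrow> poly c 1 \<noteq> z \<or> poly d 1 \<noteq> t)"
  shows "in_xztP (\<Phi> h)"
proof -
  let ?\<Psi> = "inv_into UNIV \<Phi>"
  have hom: "comm_ring_hom \<Phi>" and bij: "bij \<Phi>" and const: "\<And>c. \<Phi> (const4 c) = const4 c"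
    using \<Phi> by (auto simp: alg_automorphism_def)
  interpret comm_ring_hom \<Phi> by fact
  have "complex_automorphism ?\<Psi>" using \<Phi> by (rule complex_automorphism_inv)
  then have hom': "comm_ring_hom ?\<Psi>" and const': "\<And>c. ?\<Psi> (const4 c) = const4 c"
    by (auto simp: alg_automorphism_def)
  note ev\<Phi> = ev_alg_hom[OF hom const] and ev\<Psi> = ev_alg_hom[OF hom' const']
  note inv1 = complex_automorphism_inv(2)[OF \<Phi>] and inv2 = complex_automorphism_inv(3)[OF \<Phi>]
  have X4: "X4 \<noteq> 0" using ev_simps(2)[of 1 0 0 0] by force
  obtain Nx where Nx: "\<And>a b c d :: complex poly.
      degree a \<le> 2 \<Longrightarrow> degree b \<le> 2 \<Longrightarrow> degree c \<le> 2 \<Longrightarrow> degree d \<le> 2 \<Longrightarrow>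
      \<exists>q. degree q \<le> Nx \<and> (\<forall>s. poly q s = ev (?\<Psi> X4) (poly a s) (poly b s) (poly c s) (poly d s))"
    using degree_ev_curve[of "?\<Psi> X4"] by blast
  obtain Ny where Ny: "\<And>a b c d :: complex poly.
      degree a \<le> 2 \<Longrightarrow> degree b \<le> 2 \<Longrightarrow> degree c \<le> 2 \<Longrightarrow> degree d \<le> 2 \<Longrightarrow>
      \<exists>q. degree q \<le> Ny \<and> (\<forall>s. poly q s = ev (?\<Psi> vy) (poly a s) (poly b s) (poly c s) (poly d s))"
    using degree_ev_curve[of "?\<Psi> vy"] by blast
  obtain Nz where Nz: "\<And>a b c d :: complex poly.
      degree a \<le> 2 \<Longrightarrow> degree b \<le> 2 \<Longrightarrow> degree c \<le> 2 \<Longrightarrow> degree d \<le> 2 \<Longrightarrow>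
      \<exists>q. degree q \<le> Nz \<and> (\<forall>s. poly q s = ev (?\<Psi> Z4) (poly a s) (poly b s) (poly c s) (poly d s))"
    using degree_ev_curve[of "?\<Psi> Z4"] by blast
  obtain Nt where Nt: "\<And>a b c d :: complex poly.
      degree a \<le> 2 \<Longrightarrow> degree b \<le> 2 \<Longrightarrow> degree c \<le> 2 \<Longrightarrow> degree d \<le> 2 \<Longrightarrow>
      \<exists>q. degree q \<le> Nt \<and> (\<forall>s. poly q s = ev (?\<Psi> T4) (poly a s) (poly b s) (poly c s) (poly d s))"
    using degree_ev_curve[of "?\<Psi> T4"] by blast
  let ?N = "Nx + Ny + Nz + Nt"
  show ?thesis
  proof (rule flow_curve_invariant_in_xztP[of "\<Phi> X4" ?N])
    show "\<Phi> X4 \<noteq> 0" using X4 inv1[of X4] inv1[of 0] by auto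
    fix x y z t
    define x' y' z' t' where pt: "x' = ev (\<Phi> X4) x y z t" "y' = ev (\<Phi> vy) x y z t"
      "z' = ev (\<Phi> Z4) x y z t" "t' = ev (\<Phi> T4) x y z t"
    obtain a b c d where deg: "degree a \<le> 2" "degree b \<le> 2" "degree c \<le> 2" "degree d \<le> 2"
      and start: "poly a 0 = x'" "poly b 0 = y'" "poly c 0 = z'" "poly d 0 = t'"
      and h: "\<And>s. ev h (poly a s) (poly b s) (poly c s) (poly d s) = ev h x' y' z' t'"
      and P: "\<And>s. ev poly_P (poly a s) (poly b s) (poly c s) (poly d s) = ev poly_P x' y' z' t'"
      and nc: "x' \<noteq> 0 \<Longrightarrow> poly c 1 \<noteq> z' \<or> poly d 1 \<noteq> t'"
      using flow[of x' y' z' t'] by blast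
    obtain qx where qx: "degree qx \<le> Nx"
      "\<And>s. poly qx s = ev (?\<Psi> X4) (poly a s) (poly b s) (poly c s) (poly d s)" using Nx[OF deg] by blast
    obtain qy where qy: "degree qy \<le> Ny"
      "\<And>s. poly qy s = ev (?\<Psi> vy) (poly a s) (poly b s) (poly c s) (poly d s)" using Ny[OF deg] by blast
    obtain qz where qz: "degree qz \<le> Nz"
      "\<And>s. poly qz s = ev (?\<Psi> Z4) (poly a s) (poly b s) (poly c s) (poly d s)" using Nz[OF deg] by blast
    obtain qt where qt: "degree qt \<le> Nt"
      "\<And>s. poly qt s = ev (?\<Psi> T4) (poly a s) (poly b s) (poly c s) (poly d s)" using Nt[OF deg] by blast
    have pull: "ev (\<Phi> f) (poly qx s) (poly qy s) (poly qz s) (poly qt s) =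
        ev f (poly a s) (poly b s) (poly c s) (poly d s)" for f s
      unfolding qx qy qz qt ev\<Psi>[symmetric] inv1 ..
    have \<Phi>ev: "ev (\<Phi> f) x y z t = ev f x' y' z' t'" for f
      unfolding pt by (rule ev\<Phi>)
    have start': "poly qx 0 = x" "poly qy 0 = y" "poly qz 0 = z" "poly qt 0 = t"
      unfolding qx qy qz qt start \<Phi>ev[symmetric] inv2 by simp_all
    have "ev poly_P (poly qx s) (poly qy s) (poly qz s) (poly qt s) = ev poly_P x y z t" for s
    proof -
      have "ev (\<Phi> poly_P) (poly qx s) (poly qy s) (poly qz s) (poly qt s) = ev (\<Phi> poly_P) x y z t"
        unfolding pull P \<Phi>ev ..
      then show ?thesis using \<Phi>P by simp
    qed
    moreover have "degree qx > 0 \<or> degree qy > 0 \<or> degree qz > 0 \<or> degree qt > 0"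
      if "ev (\<Phi> X4) x y z t \<noteq> 0"
    proof (rule ccontr)
      assume "\<not> ?thesis"
      then have "poly qx 1 = poly qx 0" "poly qy 1 = poly qy 0" "poly qz 1 = poly qz 0" "poly qt 1 = poly qt 0"
        by (auto elim!: degree_eq_zeroE)
      then have "ev f (poly a 1) (poly b 1) (poly c 1) (poly d 1) =
          ev f (poly a 0) (poly b 0) (poly c 0) (poly d 0)" for f
        unfolding pull[symmetric] by simp
      from this[of Z4] this[of T4] show False using nc start that pt by simp
    qed
    ultimately show "\<exists>cx cy cz ct. degree cx \<le> ?N \<and> degree cy \<le> ?N \<and> degree cz \<le> ?N \<and> degree ct \<le> ?N \<and>
      poly cx 0 = x \<and> poly cy 0 = y \<and> poly cz 0 = z \<and> poly ct 0 = t \<and>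
      (\<forall>s. ev (\<Phi> h) (poly cx s) (poly cy s) (poly cz s) (poly ct s) = ev (\<Phi> h) x y z t) \<and>
      (\<forall>s. ev poly_P (poly cx s) (poly cy s) (poly cz s) (poly ct s) = ev poly_P x y z t) \<and>
      (ev (\<Phi> X4) x y z t \<noteq> 0 \<longrightarrow> degree cx > 0 \<or> degree cy > 0 \<or> degree cz > 0 \<or> degree ct > 0)"
      using qx(1) qy(1) qz(1) qt(1) start' pull h \<Phi>ev
      by (intro exI[of _ qx] exI[of _ qy] exI[of _ qz] exI[of _ qt]) auto
  qed
qed

text \<open>
The two flows are the exponentials of the locally nilpotent derivations
\<open>x^2 d/dz - (2 z t^2 + 1) d/dy\<close> and \<open>x^2 d/dt - 2 z^2 t d/dy\<close>, which kill \<open>P\<close>. The first one also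
kills \<open>x\<close> and \<open>t\<close>, the second one also kills \<open>z\<close>.
\<close>

lemma generators_in_xztP:
  assumes \<Phi>: "complex_automorphism \<Phi>" and \<Phi>P: "\<Phi> poly_P = const4 \<kappa> * poly_P" "\<kappa> \<noteq> 0"
  shows "in_xztP (\<Phi> X4)" "in_xztP (\<Phi> Z4)" "in_xztP (\<Phi> T4)"
proof -
  note flow = flow_invariant_in_xztP[OF \<Phi> \<Phi>P]
  show "in_xztP (\<Phi> X4)" "in_xztP (\<Phi> T4)"
    by (rule flow, rule_tac x = "[:x:]" in exI,
        rule_tac x = "[:y, - (2 * z * t\<^sup>2 + 1), - (t\<^sup>2 * x\<^sup>2):]" in exI,
        rule_tac x = "[:z, x\<^sup>2:]" in exI, rule_tac x = "[:t:]" in exI,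
        simp add: power2_eq_square algebra_simps)+
  show "in_xztP (\<Phi> Z4)"
    by (rule flow, rule_tac x = "[:x:]" in exI,
        rule_tac x = "[:y, - (2 * z\<^sup>2 * t), - (z\<^sup>2 * x\<^sup>2):]" in exI,
        rule_tac x = "[:z:]" in exI, rule_tac x = "[:t, x\<^sup>2:]" in exI,
        simp add: power2_eq_square algebra_simps)
qed

text \<open>
In the argument of \<open>subst_P\<close> the variable \<open>y\<close> is a placeholder \<open>v\<close> for \<open>P\<close>. This identifies the
polynomial ring \<open>C[x,v,z,t]\<close> with the subring \<open>C[x,z,t,P]\<close>.
\<close>

definition subst_P :: "xyzt_poly \<Rightarrow> xyzt_poly" where "subst_P F = pcompose F poly_P"

lemma poly_P_eq: "poly_P = [:poly_r0, vx\<^sup>2:]"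
  by (simp add: poly_P_def incl_def vy_def poly_const_pow)

lemma degree_poly_P: "degree poly_P = 1"
  by (simp add: poly_P_eq vx_def)

lemma subst_P_simps [simp]:
  "subst_P (incl g) = incl g" "subst_P vy = poly_P"
  "subst_P (F + G) = subst_P F + subst_P G" "subst_P (F - G) = subst_P F - subst_P G"
  "subst_P (F * G) = subst_P F * subst_P G" "subst_P (F ^ n) = subst_P F ^ n"
  "subst_P 0 = 0" "subst_P 1 = 1"
proof -
  show mult: "subst_P (F * G) = subst_P F * subst_P G" for F G
    by (simp add: subst_P_def pcompose_mult)
  show one: "subst_P 1 = 1" by (simp add: subst_P_def pcompose_1)
  show "subst_P (F ^ n) = subst_P F ^ n" by (induction n) (simp_all add: mult one)
qed (simp_all add: subst_P_def incl_def vy_def pcompose_pCons pcompose_add pcompose_diff)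

lemma subst_P_sum: "subst_P (sum f S) = (\<Sum>i\<in>S. subst_P (f i))"
  by (simp add: subst_P_def pcompose_sum)

lemma subst_P_eq_iff [simp]: "subst_P F = subst_P G \<longleftrightarrow> F = G"
proof
  assume "subst_P F = subst_P G"
  then have "pcompose (F - G) poly_P = 0" by (simp add: subst_P_def pcompose_diff)
  then have "F - G = 0" by (rule pcompose_eq_0) (simp add: degree_poly_P)
  then show "F = G" by simp
qed simp

lemma in_xztP_incl [simp]: "in_xztP (incl g)"
  by (simp add: in_xztP_def incl_def coeff_pCons split: nat.splits)

lemma in_xztP_add: "in_xztP f \<Longrightarrow> in_xztP g \<Longrightarrow> in_xztP (f + g)"
  by (simp add: in_xztP_def)

lemma in_xztP_mult:
  assumes "in_xztP f" "in_xztP g"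
  shows "in_xztP (f * g)"
  unfolding in_xztP_def coeff_mult
proof (intro allI dvd_sum)
  fix n i :: nat assume "i \<in> {..n}"
  then have "2 * n = 2 * i + 2 * (n - i)" by simp
  then have "vx ^ (2 * n) = vx ^ (2 * i) * vx ^ (2 * (n - i))" by (metis power_add)
  then show "vx ^ (2 * n) dvd coeff f i * coeff g (n - i)"
    using assms by (simp add: in_xztP_def mult_dvd_mono)
qed

lemma in_xztP_P [simp]: "in_xztP poly_P"
  by (auto simp: in_xztP_def poly_P_eq coeff_pCons power2_eq_square split: nat.splits)

lemma in_xztP_subst_P: "in_xztP (subst_P F)"
  by (induction F rule: xyzt_induct) (simp_all add: in_xztP_add in_xztP_mult)

lemma in_xztP_imp_subst_P:
  assumes "in_xztP f"
  shows "\<exists>F. f = subst_P F"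
proof -
  obtain g where g: "\<And>j. coeff f j = vx ^ (2 * j) * g j"
  proof -
    have "\<forall>j. \<exists>k. coeff f j = vx ^ (2 * j) * k" using assms by (auto simp: in_xztP_def dvd_def)
    from choice[OF this] show thesis using that by blast
  qed
  have y: "X4\<^sup>2 * vy = subst_P (vy - incl poly_r0)" by (simp add: poly_P_def)
  have "f = (\<Sum>j\<le>degree f. monom (coeff f j) j)" by (simp add: poly_as_sum_of_monoms)
  also have "\<dots> = (\<Sum>j\<le>degree f. incl (g j) * (X4\<^sup>2 * vy) ^ j)"
  proof (intro sum.cong refl)
    fix j
    have "monom (coeff f j) j = incl (coeff f j) * vy ^ j"
      by (simp add: incl_def vy_def monom_altdef)
    then show "monom (coeff f j) j = incl (g j) * (X4\<^sup>2 * vy) ^ j"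
      by (simp add: g power_mult_distrib mult_ac flip: power_mult)
  qed
  also have "\<dots> = subst_P (\<Sum>j\<le>degree f. incl (g j) * (vy - incl poly_r0) ^ j)"
    unfolding y subst_P_sum by simp
  finally show ?thesis ..
qed

lemma automorphism_preserves_xztP:
  assumes \<Phi>: "complex_automorphism \<Phi>" and \<Phi>P: "\<Phi> poly_P = const4 \<kappa> * poly_P" "\<kappa> \<noteq> 0"
    and f: "in_xztP f"
  shows "in_xztP (\<Phi> f)"
proof -
  have hom: "comm_ring_hom \<Phi>" and const: "\<And>c. \<Phi> (const4 c) = const4 c"
    using \<Phi> by (auto simp: alg_automorphism_def)
  interpret comm_ring_hom \<Phi> by fact
  obtain F where F: "f = subst_P F" using in_xztP_imp_subst_P f by blast
  have "in_xztP (\<Phi> (subst_P F))"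
    by (induction F rule: xyzt_induct)
      (simp_all add: const hom_add hom_mult in_xztP_add in_xztP_mult \<Phi>P generators_in_xztP[OF \<Phi> \<Phi>P])
  then show ?thesis by (simp add: F)
qed

lemma unit_is_const:
  assumes "f dvd (1 :: xyzt_poly)"
  obtains c where "c \<noteq> 0" "f = const4 c"
proof -
  obtain a where a: "f = [:a:]" "a dvd 1" using assms is_unit_poly_iff by blast
  obtain b where b: "a = [:b:]" "b dvd 1" using a(2) is_unit_poly_iff by blast
  obtain d where d: "b = [:d:]" "d dvd 1" using b(2) is_unit_poly_iff by blast
  obtain c where c: "d = [:c:]" "c dvd 1" using d(2) is_unit_poly_iff by blast
  show thesis by (rule that[of c]) (use a b d c in \<open>auto simp: incl_def const3_def\<close>)
qed

lemma P_nonzero: "poly_P \<noteq> 0"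
  using degree_poly_P by auto

lemma image_of_P:
  assumes \<Phi>: "complex_automorphism \<Phi>" and ideal: "\<Phi> ` {f. poly_P dvd f} = {f. poly_P dvd f}"
  obtains \<kappa> where "\<kappa> \<noteq> 0" "\<Phi> poly_P = const4 \<kappa> * poly_P"
proof -
  interpret comm_ring_hom \<Phi> using \<Phi> by (simp add: alg_automorphism_def)
  have "\<Phi> poly_P \<in> \<Phi> ` {f. poly_P dvd f}" by (intro imageI) simp
  then have "poly_P dvd \<Phi> poly_P" unfolding ideal by (rule CollectD)
  then obtain g where g: "\<Phi> poly_P = poly_P * g" by (rule dvdE)
  have "poly_P \<in> \<Phi> ` {f. poly_P dvd f}" unfolding ideal by simp
  then obtain q where q: "poly_P = \<Phi> q" "q \<in> {f. poly_P dvd f}" by (rule imageE)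
  from q(2) have "poly_P dvd q" by (rule CollectD)
  then obtain h where h: "q = poly_P * h" by (rule dvdE)
  have "poly_P = \<Phi> (poly_P * h)" using q(1) unfolding h .
  then have "poly_P * (g * \<Phi> h) = poly_P * 1" by (simp add: hom_mult g mult_ac)
  then have "g * \<Phi> h = 1" by (simp only: mult_cancel_left P_nonzero simp_thms)
  then have "g dvd 1" using dvd_triv_left[of g "\<Phi> h"] by (simp only:)
  then obtain \<kappa> where "\<kappa> \<noteq> 0" "g = const4 \<kappa>" by (rule unit_is_const)
  then show thesis using g by (intro that[of \<kappa>]) (simp_all add: mult.commute)
qed

lemma inverse_image_of_P:
  assumes \<Phi>: "complex_automorphism \<Phi>" and \<Phi>P: "\<Phi> poly_P = const4 \<kappa> * poly_P" "\<kappa> \<noteq> 0"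
  shows "inv_into UNIV \<Phi> poly_P = const4 (1 / \<kappa>) * poly_P"
proof -
  have const: "\<And>c. \<Phi> (const4 c) = const4 c" and "comm_ring_hom \<Phi>"
    using \<Phi> by (simp_all add: alg_automorphism_def)
  interpret comm_ring_hom \<Phi> by fact
  have "const4 (1 / \<kappa>) * const4 \<kappa> = 1"
    using \<Phi>P(2) by (simp add: incl_def const3_def one_pCons)
  then have "\<Phi> (const4 (1 / \<kappa>) * poly_P) = poly_P"
    by (simp add: hom_mult const \<Phi>P mult.assoc[symmetric])
  then show ?thesis using complex_automorphism_inv(2)[OF \<Phi>] by metis
qed

lemma prime_elem_X4: "prime_elem X4"
proof -
  have "prime_elem [:0, 1 :: complex:]" by (rule prime_elem_linear_field_poly) simp
  then show ?thesis unfolding incl_def vx_def by (intro lift_prime_elem_poly)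
qed

lemma X4_power_clears:
  "\<exists>n. in_xztP (X4 ^ n * f)"
proof (intro exI[of _ "2 * degree f"], unfold in_xztP_def, intro allI)
  fix j
  have "coeff (X4 ^ (2 * degree f) * f) j = vx ^ (2 * degree f) * coeff f j"
    by (simp add: incl_def poly_const_pow)
  moreover have "vx ^ (2 * j) dvd vx ^ (2 * degree f)" if "j \<le> degree f"
    using that by (intro le_imp_power_dvd) simp
  ultimately show "vx ^ (2 * j) dvd coeff (X4 ^ (2 * degree f) * f) j"
    by (cases "j \<le> degree f") (simp_all add: coeff_eq_0)
qed

text \<open>
Elements \<open>a\<close> of \<open>C[x,z,t,P]\<close> such that a power of \<open>a\<close> multiplies \<open>y\<close> into this subring are
divisible by \<open>x\<close>. Now \<open>x^n\<close> multiplies the preimage of \<open>y\<close> into the subring for large \<open>n\<close>, and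
applying \<open>\<Phi>\<close>, which preserves the subring, shows that \<open>\<Phi> x\<close> has this property.
\<close>

lemma X4_dvd_image:
  assumes \<Phi>: "complex_automorphism \<Phi>" and \<Phi>P: "\<Phi> poly_P = const4 \<kappa> * poly_P" "\<kappa> \<noteq> 0"
  shows "X4 dvd \<Phi> X4"
proof -
  interpret comm_ring_hom \<Phi> using \<Phi> by (simp add: alg_automorphism_def)
  obtain n where "in_xztP (X4 ^ n * inv_into UNIV \<Phi> vy)" using X4_power_clears by blast
  then have "in_xztP (\<Phi> (X4 ^ n * inv_into UNIV \<Phi> vy))"
    by (rule automorphism_preserves_xztP[OF \<Phi> \<Phi>P])
  then have *: "in_xztP (pCons 0 (\<Phi> X4 ^ n))"
    by (simp add: hom_mult hom_power complex_automorphism_inv(3)[OF \<Phi>] vy_def)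
  have "vx dvd coeff (\<Phi> X4 ^ n) j" for j
  proof -
    have "vx ^ (2 * Suc j) dvd coeff (\<Phi> X4 ^ n) j" using * unfolding in_xztP_def
      by (metis coeff_pCons_Suc)
    then show ?thesis by (rule dvd_trans[rotated]) simp
  qed
  then have "X4 dvd \<Phi> X4 ^ n" by (simp add: incl_def const_poly_dvd_iff)
  then show ?thesis using prime_elem_dvd_power[OF prime_elem_X4] by blast
qed

lemma automorphism_fixes_X4_up_to_scalar:
  assumes \<Phi>: "complex_automorphism \<Phi>" and \<Phi>P: "\<Phi> poly_P = const4 \<kappa> * poly_P" "\<kappa> \<noteq> 0"
  obtains u where "\<Phi> X4 = const4 u * X4"
proof -
  interpret comm_ring_hom \<Phi> using \<Phi> by (simp add: alg_automorphism_def)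
  let ?\<Psi> = "inv_into UNIV \<Phi>"
  note inv = complex_automorphism_inv[OF \<Phi>]
  have "X4 dvd ?\<Psi> X4"
    by (rule X4_dvd_image[OF inv(1) inverse_image_of_P[OF \<Phi> \<Phi>P]]) (use \<Phi>P in simp)
  then obtain h where h: "?\<Psi> X4 = X4 * h" by auto
  obtain g where g: "\<Phi> X4 = X4 * g" using X4_dvd_image[OF \<Phi> \<Phi>P] by auto
  have "X4 = \<Phi> (X4 * h)" using h inv(3)[of X4] by simp
  then have "X4 * (g * \<Phi> h) = X4 * 1" by (simp add: hom_mult g mult_ac)
  then have "g * \<Phi> h = 1"
    by (simp only: mult_cancel_left prime_elem_not_zeroI[OF prime_elem_X4] simp_thms)
  then have "g dvd 1" using dvd_triv_left[of g "\<Phi> h"] by (simp only:)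
  then obtain u where "g = const4 u" by (rule unit_is_const)
  then show thesis using g by (intro that[of u]) (simp add: mult.commute)
qed

section \<open>Partial derivatives and potentials\<close>

definition derivation :: "('a::comm_ring_1 \<Rightarrow> 'a) \<Rightarrow> bool" where
  "derivation d \<longleftrightarrow> (\<forall>a b. d (a + b) = d a + d b) \<and> (\<forall>a b. d (a * b) = a * d b + d a * b)"

lemma derivation_simps:
  assumes "derivation d"
  shows "d (a + b) = d a + d b" "d (a * b) = a * d b + d a * b" "d 0 = 0" "d 1 = 0"
    "d (- a) = - d a" "d (a - b) = d a - d b" "d (a\<^sup>2) = 2 * a * d a"
proof -
  show add: "d (a + b) = d a + d b" and mult: "d (a * b) = a * d b + d a * b" for a b
    using assms by (simp_all add: derivation_def)
  show zero: "d 0 = 0" using add[of 0 0] by simp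
  show "d 1 = 0" using mult[of 1 1] by simp
  show neg: "d (- a) = - d a" for a using add[of a "- a"] zero by (simp add: add_eq_0_iff)
  show "d (a - b) = d a - d b" using add[of a "- b"] neg by simp
  show "d (a\<^sup>2) = 2 * a * d a" by (simp add: power2_eq_square mult)
qed

lemma derivation_pderiv: "derivation (pderiv :: 'a::idom poly \<Rightarrow> _)"
  by (simp add: derivation_def pderiv_add pderiv_mult mult.commute)

lemma derivation_map_poly:
  assumes "derivation d"
  shows "derivation (map_poly d)"
proof -
  note d = derivation_simps[OF assms]
  have sum: "d (sum f S) = (\<Sum>i\<in>S. d (f i))" for f and S :: "nat set"
    by (induction S rule: infinite_finite_induct) (simp_all add: d)
  show ?thesis unfolding derivation_def
    by (auto intro!: poly_eqI simp: coeff_map_poly coeff_mult sum d sum.distrib)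
qed

definition dX :: "xyzt_poly \<Rightarrow> xyzt_poly" where "dX = map_poly (map_poly (map_poly pderiv))"
definition dY :: "xyzt_poly \<Rightarrow> xyzt_poly" where "dY = pderiv"
definition dZ :: "xyzt_poly \<Rightarrow> xyzt_poly" where "dZ = map_poly d_z"
definition dT :: "xyzt_poly \<Rightarrow> xyzt_poly" where "dT = map_poly d_t"

lemma derivation_partials: "derivation dX" "derivation dY" "derivation dZ" "derivation dT"
  unfolding dX_def dY_def dZ_def dT_def d_z_def d_t_def
  by (intro derivation_map_poly derivation_pderiv)+

lemmas partials_simps =
  derivation_simps[OF derivation_partials(1)] derivation_simps[OF derivation_partials(2)]
  derivation_simps[OF derivation_partials(3)] derivation_simps[OF derivation_partials(4)]

lemma partials_generators [simp]:
  "dX (const4 c) = 0" "dX X4 = 1" "dX vy = 0" "dX Z4 = 0" "dX T4 = 0"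
  "dY (const4 c) = 0" "dY X4 = 0" "dY vy = 1" "dY Z4 = 0" "dY T4 = 0"
  "dZ (const4 c) = 0" "dZ X4 = 0" "dZ vy = 0" "dZ Z4 = 1" "dZ T4 = 0"
  "dT (const4 c) = 0" "dT X4 = 0" "dT vy = 0" "dT Z4 = 0" "dT T4 = 1"
  by (simp_all add: dX_def dY_def dZ_def dT_def d_z_def d_t_def incl_def const3_def
      vx_def vy_def vz_def vt_def map_poly_pCons pderiv_pCons one_pCons)

lemma coeff4_partials:
  "coeff4 (dX f) (i, j, k, l) = of_nat (Suc i) * coeff4 f (Suc i, j, k, l)"
  "coeff4 (dZ f) (i, j, k, l) = of_nat (Suc k) * coeff4 f (i, j, Suc k, l)"
  "coeff4 (dT f) (i, j, k, l) = of_nat (Suc l) * coeff4 f (i, j, k, Suc l)"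
proof -
  have of_nat_coeff: "coeff (of_nat n * p) m = of_nat n * coeff p m" for n m and p :: "'b::comm_ring_1 poly"
    by (simp add: of_nat_poly)
  show "coeff4 (dX f) (i, j, k, l) = of_nat (Suc i) * coeff4 f (Suc i, j, k, l)"
    "coeff4 (dZ f) (i, j, k, l) = of_nat (Suc k) * coeff4 f (i, j, Suc k, l)"
    "coeff4 (dT f) (i, j, k, l) = of_nat (Suc l) * coeff4 f (i, j, k, Suc l)"
    by (simp_all add: dX_def dZ_def dT_def d_z_def d_t_def coeff_map_poly coeff_pderiv of_nat_coeff
        del: of_nat_Suc)
qed

lemma partials_commute: "dX (dZ f) = dZ (dX f)" "dX (dT f) = dT (dX f)" "dZ (dT f) = dT (dZ f)"
  by (rule coeff4_eqI, clarify, simp only: coeff4_partials mult_ac)+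

lemma exists_coeff4:
  assumes "finite {m. h m \<noteq> 0}"
  shows "\<exists>H. \<forall>m. coeff4 H m = h m"
  by (rule exI[of _ "\<Sum>m | h m \<noteq> 0. mono4 (h m) m"])
    (simp add: coeff4_sum coeff4_mono4 assms)

text \<open>
The coefficients of a potential \<open>H\<close> are those of \<open>A\<close> divided by the exponent of \<open>z\<close>; the terms of
\<open>H\<close> without \<open>z\<close> come from \<open>B\<close>. Both \<open>x\<close> and \<open>y\<close> are parameters.
\<close>

lemma poincare:
  assumes "dT A = dZ B"
  obtains H where "dZ H = A" "dT H = B"
proof -
  define h where "h = (\<lambda>(i, j, k, l). if k > 0 then coeff4 A (i, j, k - 1, l) / of_nat k
    else if l > 0 then coeff4 B (i, j, 0, l - 1) / of_nat l else 0)"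
  have "{m. h m \<noteq> 0} \<subseteq> (\<lambda>(i, j, k, l). (i, j, Suc k, l)) ` supp4 A \<union> (\<lambda>(i, j, k, l). (i, j, k, Suc l)) ` supp4 B"
  proof
    fix m assume m: "m \<in> {m. h m \<noteq> 0}"
    obtain i j k l where ijkl: "m = (i, j, k, l)" by (cases m)
    show "m \<in> (\<lambda>(i, j, k, l). (i, j, Suc k, l)) ` supp4 A \<union> (\<lambda>(i, j, k, l). (i, j, k, Suc l)) ` supp4 B"
    proof (cases "k > 0")
      case True
      then have "(i, j, k - 1, l) \<in> supp4 A" using m ijkl by (auto simp: h_def supp4_def)
      then show ?thesis using True ijkl by (intro UnI1 image_eqI[of _ _ "(i, j, k - 1, l)"]) auto
    next
      case False
      then have "l > 0" "(i, j, 0, l - 1) \<in> supp4 B"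
        using m ijkl by (auto simp: h_def supp4_def split: if_splits)
      then show ?thesis using False ijkl by (intro UnI2 image_eqI[of _ _ "(i, j, 0, l - 1)"]) auto
    qed
  qed
  then have "finite {m. h m \<noteq> 0}" by (rule finite_subset) (simp add: finite_supp4)
  then obtain H where H: "\<And>m. coeff4 H m = h m" using exists_coeff4 by blast
  have closed: "of_nat (Suc l) * coeff4 A (i, j, k, Suc l) = of_nat (Suc k) * coeff4 B (i, j, Suc k, l)" for i j k l
    using arg_cong[OF assms, of "\<lambda>f. coeff4 f (i, j, k, l)"] by (simp only: coeff4_partials)
  show thesis
  proof (rule that[of H])
    show "dZ H = A"
      by (rule coeff4_eqI, clarify) (simp add: coeff4_partials H h_def del: of_nat_Suc coeff4.simps)
    show "dT H = B"
    proof (rule coeff4_eqI, clarify)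
      fix i j k l
      show "coeff4 (dT H) (i, j, k, l) = coeff4 B (i, j, k, l)"
      proof (cases k)
        case 0
        then show ?thesis by (simp add: coeff4_partials H h_def del: of_nat_Suc coeff4.simps)
      next
        case (Suc k')
        then have "coeff4 (dT H) (i, j, k, l) = of_nat (Suc l) * coeff4 A (i, j, k', Suc l) / of_nat (Suc k')"
          by (simp add: coeff4_partials H h_def del: of_nat_Suc coeff4.simps)
        then show ?thesis unfolding closed using Suc by (simp del: of_nat_Suc coeff4.simps)
      qed
    qed
  qed
qed

lemma derivation_comp_hom:
  assumes \<alpha>: "comm_ring_hom \<alpha>" "\<And>c. \<alpha> (const4 c) = const4 c"
    and d: "derivation d" "\<And>c. d (const4 c) = 0"
  shows "d (\<alpha> f) = \<alpha> (dX f) * d (\<alpha> X4) + \<alpha> (dY f) * d (\<alpha> vy) + \<alpha> (dZ f) * d (\<alpha> Z4) + \<alpha> (dT f) * d (\<alpha> T4)"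
proof -
  interpret comm_ring_hom \<alpha> by fact
  show ?thesis
  proof (induction f rule: xyzt_induct)
    case (add f g)
    then show ?case by (simp add: hom_add partials_simps derivation_simps[OF d(1)] algebra_simps)
  next
    case (mult f g)
    then show ?case by (simp add: hom_add hom_mult partials_simps derivation_simps[OF d(1)] algebra_simps)
  qed (simp_all add: \<alpha>(2) d(2))
qed

lemma ev_has_field_derivative:
  assumes "(x has_field_derivative x') (at w within S)" "(y has_field_derivative y') (at w within S)"
    "(z has_field_derivative z') (at w within S)" "(t has_field_derivative t') (at w within S)"
  shows "((\<lambda>w. ev f (x w) (y w) (z w) (t w)) has_field_derivative
    ev (dX f) (x w) (y w) (z w) (t w) * x' + ev (dY f) (x w) (y w) (z w) (t w) * y' +
    ev (dZ f) (x w) (y w) (z w) (t w) * z' + ev (dT f) (x w) (y w) (z w) (t w) * t') (at w within S)"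
proof (induction f rule: xyzt_induct)
  case (add f g)
  show ?case unfolding ev_simps
    by (rule DERIV_cong[OF DERIV_add[OF add]]) (simp add: partials_simps algebra_simps)
next
  case (mult f g)
  show ?case unfolding ev_simps
    by (rule DERIV_cong[OF DERIV_mult[OF mult]]) (simp add: partials_simps algebra_simps)
qed (use assms in simp_all)

lemma tendsto_ev:
  assumes "(x \<longlongrightarrow> x') F" "(y \<longlongrightarrow> y') F" "(z \<longlongrightarrow> z') F" "(t \<longlongrightarrow> t') F"
  shows "((\<lambda>w. ev f (x w) (y w) (z w) (t w)) \<longlongrightarrow> ev f x' y' z' t') F"
  by (induction f rule: xyzt_induct) (use assms in \<open>simp_all add: tendsto_add tendsto_mult\<close>)

section \<open>The Hamiltonian attached to an extension\<close>

text \<open>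
An automorphism that preserves the ideal of \<open>P\<close> restricts to \<open>C[x,z,t,P]\<close>, and so does its inverse;
in the coordinates \<open>x, v, z, t\<close> of the subring the restriction is an automorphism \<open>\<alpha>\<close> of a
polynomial ring.
\<close>

lemma restrict_to_subst_P:
  assumes \<Phi>: "complex_automorphism \<Phi>" and \<Phi>P: "\<Phi> poly_P = const4 \<kappa> * poly_P" "\<kappa> \<noteq> 0"
  obtains \<alpha> where "complex_automorphism \<alpha>" "\<And>F. subst_P (\<alpha> F) = \<Phi> (subst_P F)"
proof -
  have const: "\<And>c. \<Phi> (const4 c) = const4 c" and "comm_ring_hom \<Phi>"
    using \<Phi> by (simp_all add: alg_automorphism_def)
  interpret comm_ring_hom \<Phi> by fact
  let ?\<Psi> = "inv_into UNIV \<Phi>"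
  note inv = complex_automorphism_inv[OF \<Phi>]
  have "\<forall>F. \<exists>G. subst_P G = \<Phi> (subst_P F)"
    using in_xztP_imp_subst_P automorphism_preserves_xztP[OF \<Phi> \<Phi>P in_xztP_subst_P] by metis
  from choice[OF this] obtain \<alpha> where \<alpha>: "\<And>F. subst_P (\<alpha> F) = \<Phi> (subst_P F)" by blast
  have eqI: "F = G" if "subst_P F = subst_P G" for F G using that by simp
  have "comm_ring_hom \<alpha>"
    by unfold_locales (rule eqI, simp add: \<alpha> hom_add hom_mult)+
  moreover have "\<alpha> (const4 c) = const4 c" for c
    by (rule eqI) (simp only: \<alpha> subst_P_simps const)
  moreover have "bij \<alpha>"
  proof (rule bijI)
    show "inj \<alpha>"
    proof (rule injI)
      fix F G assume "\<alpha> F = \<alpha> G"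
      then have "\<Phi> (subst_P F) = \<Phi> (subst_P G)" by (simp flip: \<alpha>)
      then have "subst_P F = subst_P G" using inv(2) by metis
      then show "F = G" by simp
    qed
    show "surj \<alpha>"
    proof (rule surjI)
      fix G
      have "in_xztP (?\<Psi> (subst_P G))"
        by (rule automorphism_preserves_xztP[OF inv(1) inverse_image_of_P[OF \<Phi> \<Phi>P] _ in_xztP_subst_P]) (use \<Phi>P in simp)
      then obtain F where F: "?\<Psi> (subst_P G) = subst_P F" using in_xztP_imp_subst_P by blast
      have "subst_P (\<alpha> F) = subst_P G" unfolding \<alpha> F[symmetric] inv(3) ..
      then show "\<alpha> (SOME F. \<alpha> F = G) = G" by (intro someI) (simp only: subst_P_eq_iff)
    qed
  qed
  ultimately show thesis using \<alpha> by (intro that[of \<alpha>]) (auto simp: alg_automorphism_def)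
qed

text \<open>
By the chain rule the Jacobian determinant in \<open>z\<close> and \<open>t\<close> times the one of the inverse is \<open>1\<close>, and
the units of a polynomial ring are constants.
\<close>

lemma jacobian_constant:
  assumes \<alpha>: "complex_automorphism \<alpha>" and X: "\<alpha> X4 = X4" and y: "\<alpha> vy = const4 \<kappa> * vy"
  obtains j where "dZ (\<alpha> Z4) * dT (\<alpha> T4) - dT (\<alpha> Z4) * dZ (\<alpha> T4) = const4 j"
proof -
  have hom: "comm_ring_hom \<alpha>" and const: "\<And>c. \<alpha> (const4 c) = const4 c"
    using \<alpha> by (auto simp: alg_automorphism_def)
  note inv = complex_automorphism_inv(3)[OF \<alpha>]
  have chain: "d (\<alpha> f) = \<alpha> (dZ f) * d (\<alpha> Z4) + \<alpha> (dT f) * d (\<alpha> T4)"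
    if "derivation d" "\<And>c. d (const4 c) = 0" "d X4 = 0" "d vy = 0" for d f
    using derivation_comp_hom[OF hom const that(1,2), of f] that
    by (simp add: X y derivation_simps[OF that(1)])
  have zchain: "dZ (\<alpha> f) = \<alpha> (dZ f) * dZ (\<alpha> Z4) + \<alpha> (dT f) * dZ (\<alpha> T4)"
    and tchain: "dT (\<alpha> f) = \<alpha> (dZ f) * dT (\<alpha> Z4) + \<alpha> (dT f) * dT (\<alpha> T4)" for f
    by (rule chain[OF derivation_partials(3)]; simp)
      (rule chain[OF derivation_partials(4)]; simp)
  define f where "f = inv_into UNIV \<alpha> Z4"
  define g where "g = inv_into UNIV \<alpha> T4"
  have inverse: "\<alpha> (dZ f) * dZ (\<alpha> Z4) + \<alpha> (dT f) * dZ (\<alpha> T4) = 1"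
    "\<alpha> (dZ f) * dT (\<alpha> Z4) + \<alpha> (dT f) * dT (\<alpha> T4) = 0"
    "\<alpha> (dZ g) * dZ (\<alpha> Z4) + \<alpha> (dT g) * dZ (\<alpha> T4) = 0"
    "\<alpha> (dZ g) * dT (\<alpha> Z4) + \<alpha> (dT g) * dT (\<alpha> T4) = 1"
    unfolding zchain[symmetric] tchain[symmetric] by (simp_all add: f_def g_def inv)
  have "(dZ (\<alpha> Z4) * dT (\<alpha> T4) - dT (\<alpha> Z4) * dZ (\<alpha> T4)) *
      (\<alpha> (dZ f) * \<alpha> (dT g) - \<alpha> (dT f) * \<alpha> (dZ g)) =
      (\<alpha> (dZ f) * dZ (\<alpha> Z4) + \<alpha> (dT f) * dZ (\<alpha> T4)) *
      (\<alpha> (dZ g) * dT (\<alpha> Z4) + \<alpha> (dT g) * dT (\<alpha> T4)) -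
      (\<alpha> (dZ f) * dT (\<alpha> Z4) + \<alpha> (dT f) * dT (\<alpha> T4)) *
      (\<alpha> (dZ g) * dZ (\<alpha> Z4) + \<alpha> (dT g) * dZ (\<alpha> T4))"
    by (simp add: algebra_simps)
  then have "(dZ (\<alpha> Z4) * dT (\<alpha> T4) - dT (\<alpha> Z4) * dZ (\<alpha> T4)) *
      (\<alpha> (dZ f) * \<alpha> (dT g) - \<alpha> (dT f) * \<alpha> (dZ g)) = 1"
    unfolding inverse by simp
  then have "(dZ (\<alpha> Z4) * dT (\<alpha> T4) - dT (\<alpha> Z4) * dZ (\<alpha> T4)) dvd 1"
    by (metis dvd_triv_left)
  then show thesis by (rule unit_is_const) (rule that)
qed

text \<open>
The form \<open>Z_x dT - T_x dZ\<close> in the variables \<open>z\<close> and \<open>t\<close> is closed, because its differential is the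
derivative in \<open>x\<close> of the Jacobian determinant. So it is the differential of a polynomial \<open>H\<close>.
\<close>

lemma hamiltonian:
  assumes J: "dZ Zv * dT Tv - dT Zv * dZ Tv = const4 j"
  obtains H where "dZ H = dX Zv * dZ Tv - dX Tv * dZ Zv" "dT H = dX Zv * dT Tv - dX Tv * dT Zv"
proof -
  have "dX (dZ Zv * dT Tv - dT Zv * dZ Tv) = 0" unfolding J by simp
  then have "dT (dX Zv * dZ Tv - dX Tv * dZ Zv) = dZ (dX Zv * dT Tv - dX Tv * dT Zv)"
    by (simp add: partials_simps partials_commute algebra_simps)
  then show thesis by (rule poincare) (rule that)
qed

lemma parallel_if_common_normal:
  fixes a b :: "'a::field"
  assumes 1: "a * p + b * q = 0" and 2: "a * p' + b * q' = 0" and "a \<noteq> 0 \<or> b \<noteq> 0"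
  shows "p * q' - q * p' = 0"
proof -
  have "a * (p * q' - q * p') = (a * p + b * q) * q' - q * (a * p' + b * q')"
    "b * (p * q' - q * p') = p * (a * p' + b * q') - p' * (a * p + b * q)"
    by (simp_all add: algebra_simps)
  then have "a * (p * q' - q * p') = 0" "b * (p * q' - q * p') = 0"
    unfolding 1 2 by simp_all
  then show ?thesis using assms(3) by (metis mult_eq_0_iff)
qed

text \<open>
The hypotheses say that at \<open>x = 0\<close> and \<open>v = r_0(z, t)\<close> the quantity \<open>\<kappa> v - r_0(Zv, Tv)\<close> vanishes to
second order in \<open>x\<close>. For \<open>e \<noteq> 0\<close> the level curve \<open>r_0 = e\<close> is irreducible and parametrized by
\<open>w \<mapsto> (e - w^2, w / (e - w^2))\<close>. Both the velocity of \<open>(Zv, Tv)\<close> along it and the derivative of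
\<open>(Zv, Tv)\<close> in \<open>x\<close> are orthogonal to the gradient of \<open>r_0\<close> at \<open>(Zv, Tv)\<close>, and this gradient has no zeros. They are
therefore parallel, so the form \<open>dH\<close> vanishes along the level curve and \<open>H\<close> is constant on it. As \<open>e\<close> tends to \<open>0\<close>, the points with
\<open>w = 0\<close> and \<open>w = 1\<close> tend to \<open>(0, 0)\<close> and \<open>(-1, -1)\<close>, which lie on different components of
\<open>r_0 = 0\<close>.
\<close>

lemma hamiltonian_equal_at_ends:
  assumes H: "dZ H = dX Zv * dZ Tv - dX Tv * dZ Zv" "dT H = dX Zv * dT Tv - dX Tv * dT Zv"
    and r0: "\<And>z t. let v = z * (z * t\<^sup>2 + 1) in
      ev Zv 0 v z t * (ev Zv 0 v z t * (ev Tv 0 v z t)\<^sup>2 + 1) = \<kappa> * v"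
    and dr0: "\<And>z t. let v = z * (z * t\<^sup>2 + 1) in
      (2 * ev Zv 0 v z t * (ev Tv 0 v z t)\<^sup>2 + 1) * ev (dX Zv) 0 v z t +
      2 * (ev Zv 0 v z t)\<^sup>2 * ev Tv 0 v z t * ev (dX Tv) 0 v z t = 0"
  shows "ev H 0 0 0 0 = ev H 0 0 (-1) (-1)"
proof -
  \<comment> \<open>A negative real \<open>e\<close> keeps the poles \<open>w^2 = e\<close> away from the segment from \<open>0\<close> to \<open>1\<close>.\<close>
  have level: "ev H 0 e e 0 = ev H 0 e (e - 1) (1 / (e - 1))" if e: "e = - of_real r" "r > 0" for e r
  proof -
    define z where "z w = e - w\<^sup>2" for w :: complex
    define t where "t w = w / (e - w\<^sup>2)" for w :: complex
    define U where "U w = ev Zv 0 e (z w) (t w)" for w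
    define W where "W w = ev Tv 0 e (z w) (t w)" for w
    define Om where "Om = {w :: complex. e - w\<^sup>2 \<noteq> 0}"
    have "open Om" unfolding Om_def by (intro open_Collect_neq continuous_intros)
    have O_real: "of_real x \<in> Om" for x :: real
    proof -
      have "- r - x\<^sup>2 \<noteq> 0" using e(2) zero_le_power2[of x] by linarith
      then have "complex_of_real (- r - x\<^sup>2) \<noteq> 0" by (metis of_real_eq_0_iff)
      then show ?thesis by (simp add: Om_def e)
    qed
    have v: "z w * (z w * (t w)\<^sup>2 + 1) = e" if "w \<in> Om" for w
    proof -
      have "q * (q * (w / q)\<^sup>2 + 1) = w\<^sup>2 + q" if "q \<noteq> 0" for q :: complex
        using that by (simp add: field_simps power2_eq_square)
      from this[of "e - w\<^sup>2"] that show ?thesis by (simp add: z_def t_def Om_def)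
    qed
    have zt: "(z has_field_derivative (- 2 * w)) (at w)"
      "(t has_field_derivative ((e + w\<^sup>2) / (e - w\<^sup>2)\<^sup>2)) (at w)" if "w \<in> Om" for w
      unfolding z_def[abs_def] t_def[abs_def] using that
      by (auto intro!: derivative_eq_intros simp: Om_def power2_eq_square algebra_simps)
    have deriv: "((\<lambda>w. ev H 0 e (z w) (t w)) has_field_derivative 0) (at w)" if w: "w \<in> Om" for w
    proof -
      let ?z' = "- 2 * w" and ?t' = "(e + w\<^sup>2) / (e - w\<^sup>2)\<^sup>2"
      note c = ev_has_field_derivative[OF DERIV_const DERIV_const zt[OF w]]
      define U' where "U' = ev (dZ Zv) 0 e (z w) (t w) * ?z' + ev (dT Zv) 0 e (z w) (t w) * ?t'"
      define W' where "W' = ev (dZ Tv) 0 e (z w) (t w) * ?z' + ev (dT Tv) 0 e (z w) (t w) * ?t'"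
      have U: "(U has_field_derivative U') (at w)" and W: "(W has_field_derivative W') (at w)"
        using c[of Zv 0 e] c[of Tv 0 e] by (simp_all add: U_def[abs_def] W_def[abs_def] U'_def W'_def)
      let ?a = "2 * U w * (W w)\<^sup>2 + 1" and ?b = "2 * (U w)\<^sup>2 * W w"
      have "((\<lambda>w. U w * (U w * (W w)\<^sup>2 + 1)) has_field_derivative ?a * U' + ?b * W') (at w)"
        by (auto intro!: derivative_eq_intros U W simp: power2_eq_square algebra_simps)
      moreover have "((\<lambda>w. U w * (U w * (W w)\<^sup>2 + 1)) has_field_derivative 0) (at w)"
      proof (rule has_field_derivative_transform_within_open[OF DERIV_const \<open>open Om\<close> w])
        show "\<kappa> * e = U w * (U w * (W w)\<^sup>2 + 1)" if "w \<in> Om" for w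
          using r0[of "z w" "t w"] v[OF that] by (simp add: Let_def U_def W_def)
      qed
      ultimately have 1: "?a * U' + ?b * W' = 0" by (rule DERIV_unique)
      have 2: "?a * ev (dX Zv) 0 e (z w) (t w) + ?b * ev (dX Tv) 0 e (z w) (t w) = 0"
        using dr0[of "z w" "t w"] v[OF w] by (simp add: Let_def U_def W_def)
      have "?a \<noteq> 0 \<or> ?b \<noteq> 0" by auto
      then have 3: "ev (dX Zv) 0 e (z w) (t w) * W' - ev (dX Tv) 0 e (z w) (t w) * U' = 0"
        by (rule parallel_if_common_normal[OF 2 1])
      show ?thesis
        by (rule DERIV_cong[OF c[of H 0 e]]) (use 3 in \<open>simp add: H U'_def W'_def algebra_simps\<close>)
    qed
    have segment: "w \<in> Om" if w: "w \<in> closed_segment 0 1" for w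
    proof -
      obtain u where "w = of_real u"
        using w by (auto simp: in_segment scaleR_conv_of_real)
      then show ?thesis using O_real by simp
    qed
    have "\<exists>k. \<forall>w\<in>closed_segment 0 1. ev H 0 e (z w) (t w) = k"
    proof (rule has_field_derivative_zero_constant[OF convex_closed_segment])
      show "((\<lambda>w. ev H 0 e (z w) (t w)) has_field_derivative 0) (at w within closed_segment 0 1)"
        if "w \<in> closed_segment 0 1" for w
        using deriv[OF segment[OF that]] by (rule has_field_derivative_at_within)
    qed
    then obtain k where k: "\<And>w. w \<in> closed_segment 0 1 \<Longrightarrow> ev H 0 e (z w) (t w) = k" by blast
    have "ev H 0 e (z 0) (t 0) = ev H 0 e (z 1) (t 1)"
      unfolding k[OF ends_in_segment(1)] k[OF ends_in_segment(2)] ..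
    then show ?thesis by (simp add: z_def t_def)
  qed
  define e :: "nat \<Rightarrow> complex" where "e = (\<lambda>n. - of_real (inverse (real (Suc n))))"
  have "(\<lambda>n. - of_real (inverse (real (Suc n))) :: complex) \<longlonglongrightarrow> - of_real 0"
    by (intro tendsto_intros LIMSEQ_inverse_real_of_nat)
  then have e: "e \<longlonglongrightarrow> 0" by (simp add: e_def del: of_nat_Suc)
  have e': "(\<lambda>n. e n - 1) \<longlonglongrightarrow> -1" using tendsto_diff[OF e tendsto_const[of 1]] by simp
  have "(\<lambda>n. 1 / (e n - 1)) \<longlonglongrightarrow> 1 / -1" by (rule tendsto_divide[OF tendsto_const e']) simp
  then have e'': "(\<lambda>n. 1 / (e n - 1)) \<longlonglongrightarrow> -1" by simp
  have right: "(\<lambda>n. ev H 0 (e n) (e n - 1) (1 / (e n - 1))) \<longlonglongrightarrow> ev H 0 0 (-1) (-1)"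
    by (rule tendsto_ev[OF tendsto_const e e' e''])
  have left: "(\<lambda>n. ev H 0 (e n) (e n) 0) \<longlonglongrightarrow> ev H 0 0 0 0"
    by (rule tendsto_ev[OF tendsto_const e e tendsto_const])
  have "ev H 0 (e n) (e n) 0 = ev H 0 (e n) (e n - 1) (1 / (e n - 1))" for n
    by (rule level[of _ "inverse (real (Suc n))"]) (simp_all add: e_def del: of_nat_Suc)
  then have "(\<lambda>n. ev H 0 (e n) (e n - 1) (1 / (e n - 1))) \<longlonglongrightarrow> ev H 0 0 0 0"
    using left by (simp only:)
  then show ?thesis using right by (rule LIMSEQ_unique)
qed

text \<open>
The assumptions hold for \<open>H = - z t^2 + const\<close> at \<open>x = v = 0\<close>, restricted to the diagonal \<open>z = t\<close>.
\<close>

lemma hamiltonian_distinct_at_ends: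
  assumes "\<And>r. ev (dZ H) 0 0 r r = - (r\<^sup>2)" "\<And>r. ev (dT H) 0 0 r r = - 2 * r\<^sup>2"
  shows "ev H 0 0 0 0 \<noteq> ev H 0 0 (-1) (-1)"
proof -
  have "\<exists>k. \<forall>r\<in>UNIV. ev H 0 0 r r + r ^ 3 = k"
  proof (rule has_field_derivative_zero_constant)
    fix r :: complex
    have "((\<lambda>r. ev H 0 0 r r) has_field_derivative - 3 * r\<^sup>2) (at r)"
      by (rule DERIV_cong[OF ev_has_field_derivative[OF DERIV_const DERIV_const DERIV_ident DERIV_ident]])
        (simp add: assms)
    from DERIV_add[OF this DERIV_power[OF DERIV_ident, of 3]]
    show "((\<lambda>r. ev H 0 0 r r + r ^ 3) has_field_derivative 0) (at r within UNIV)" by simp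
  qed simp
  then obtain k where k: "\<And>r. ev H 0 0 r r + r ^ 3 = k" by blast
  show ?thesis using k[of 0] k[of "-1"] by auto
qed

lemma d_z_derivation: "derivation d_z" and d_t_derivation: "derivation d_t"
  unfolding d_z_def d_t_def by (intro derivation_map_poly derivation_pderiv)+

lemma d_generators [simp]:
  "d_z vx = 0" "d_z vz = 1" "d_z vt = 0" "d_t vx = 0" "d_t vz = 0" "d_t vt = 1"
  by (simp_all add: d_z_def d_t_def vx_def vz_def vt_def map_poly_pCons pderiv_pCons one_pCons)

text \<open>
The operator \<open>x Jac(h, _)\<close> is linear over \<open>C[x]\<close>, so the values of its higher powers
are divisible by \<open>x^2\<close>.
\<close>

lemma exp_to_first_order:
  assumes "cong_exp (vx\<^sup>2) (\<lambda>f. vx * Jac h f) \<phi>"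
  shows "vx\<^sup>2 dvd \<phi> f - (f + vx * Jac h f)"
proof -
  let ?D = "\<lambda>f. vx * Jac h f"
  obtain N0 where N0: "\<And>N. N \<ge> N0 \<Longrightarrow> vx\<^sup>2 dvd \<phi> f - (\<Sum>n<N. const3 (1 / fact n) * (?D ^^ n) f)"
    using assms unfolding cong_exp_def eventually_sequentially by blast
  have 1: "vx\<^sup>2 dvd \<phi> f - (\<Sum>n<N0 + 2. const3 (1 / fact n) * (?D ^^ n) f)"
    by (rule N0) simp
  have Dx: "Jac h (vx * g) = vx * Jac h g" for g
    by (simp add: Jac_def derivation_simps[OF d_z_derivation] derivation_simps[OF d_t_derivation] algebra_simps)
  have "vx\<^sup>2 dvd (?D ^^ Suc (Suc n)) f" for n
    by (simp add: Dx power2_eq_square mult.assoc[symmetric])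
  then have 2: "vx\<^sup>2 dvd (\<Sum>n<N0. const3 (1 / fact (Suc (Suc n))) * (?D ^^ Suc (Suc n)) f)"
    by (intro dvd_sum dvd_mult)
  have "(\<Sum>n<N0 + 2. const3 (1 / fact n) * (?D ^^ n) f) =
      f + ?D f + (\<Sum>n<N0. const3 (1 / fact (Suc (Suc n))) * (?D ^^ Suc (Suc n)) f)"
    by (simp add: sum.lessThan_Suc_shift const3_def flip: one_pCons del: sum.lessThan_Suc)
  then show ?thesis using dvd_add[OF 1 2] by (simp add: algebra_simps)
qed

lemma P_dvd_incl:
  assumes "poly_P dvd incl g"
  shows "g = 0"
proof (rule ccontr)
  assume "g \<noteq> 0"
  then have "degree poly_P \<le> degree (incl g)" using assms by (intro dvd_imp_degree_le) (simp_all add: incl_def)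
  then show False by (simp add: degree_poly_P incl_def)
qed

text \<open>
Reduction modulo \<open>P\<close> of an element of \<open>C[x,z,t,P]\<close> amounts to setting \<open>v = 0\<close>, because \<open>C[x,z,t]\<close>
meets the ideal of \<open>P\<close> only in \<open>0\<close>.
\<close>

lemma subst_P_cong_incl:
  assumes "poly_P dvd subst_P F - incl g"
  obtains k where "F = incl g + vy * k"
proof -
  obtain c k where F: "F = pCons c k" by (cases F)
  then have F': "F = incl c + vy * k" by (simp add: incl_def vy_def)
  have "poly_P dvd (subst_P F - incl g) - poly_P * subst_P k" by (rule dvd_diff[OF assms]) simp
  then have "poly_P dvd incl (c - g)" by (simp add: F')
  then have "c - g = 0" by (rule P_dvd_incl)
  then show thesis using F' by (intro that[of k]) simp
qed

lemma proj_X_eq_iff: "proj_X f = proj_X g \<longleftrightarrow> poly_P dvd f - g"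
  by (rule coord_ring.abs_eq_iff)

lemma ev_subst_P: "ev (subst_P F) x y z t = ev F x (ev poly_P x y z t) z t"
  by (induction F rule: xyzt_induct) (simp_all del: ev_P)

theorem proposition5p1:
  fixes \<phi> :: "xzt_poly \<Rightarrow> xzt_poly"
    and \<phi>_lift :: "coord_ring \<Rightarrow> coord_ring"
  assumes "alg_automorphism const3 \<phi>"
    and "\<phi> vx = vx"
    and "cong_exp (vx\<^sup>2) (\<lambda>f. vx * Jac poly_h f) \<phi>"
    and "alg_automorphism scalar_X \<phi>_lift"
    and "\<forall>f. \<phi>_lift (proj_X (incl f)) = proj_X (incl (\<phi> f))"
  shows "\<not> (\<exists>\<Phi> :: xyzt_poly \<Rightarrow> xyzt_poly.
      alg_automorphism (\<lambda>c. incl (const3 c)) \<Phi> \<and>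
      \<Phi> ` {f. poly_P dvd f} = {f. poly_P dvd f} \<and>
      (\<forall>f. proj_X (\<Phi> f) = \<phi>_lift (proj_X f)))"
proof (rule notI, elim exE conjE)
  fix \<Phi>
  assume \<Phi>: "complex_automorphism \<Phi>" and ideal: "\<Phi> ` {f. poly_P dvd f} = {f. poly_P dvd f}"
    and lift: "\<forall>f. proj_X (\<Phi> f) = \<phi>_lift (proj_X f)"
  have cong: "poly_P dvd \<Phi> (incl f) - incl (\<phi> f)" for f
    using lift assms(5) by (simp flip: proj_X_eq_iff)
  obtain \<kappa> where \<kappa>: "\<kappa> \<noteq> 0" and \<Phi>P: "\<Phi> poly_P = const4 \<kappa> * poly_P"
    by (rule image_of_P[OF \<Phi> ideal])
  obtain u where u: "\<Phi> X4 = const4 u * X4"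
    by (rule automorphism_fixes_X4_up_to_scalar[OF \<Phi> \<Phi>P \<kappa>])
  have "poly_P dvd incl (const3 u * vx - vx)" using cong[of vx] assms(2) u by simp
  then have "const3 u * vx - vx = 0" by (rule P_dvd_incl)
  then have "incl (const3 u * vx) = X4" by (simp only: right_minus_eq)
  then have \<Phi>X: "\<Phi> X4 = X4" using u by simp
  obtain \<alpha> where \<alpha>: "complex_automorphism \<alpha>" and sub: "\<And>F. subst_P (\<alpha> F) = \<Phi> (subst_P F)"
    by (rule restrict_to_subst_P[OF \<Phi> \<Phi>P \<kappa>]) (rule that, assumption+)
  have eqI: "F = G" if "subst_P F = subst_P G" for F G using that by simp
  have \<alpha>X: "\<alpha> X4 = X4" by (rule eqI) (simp add: sub \<Phi>X)
  have \<alpha>y: "\<alpha> vy = const4 \<kappa> * vy" by (rule eqI) (simp add: sub \<Phi>P)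
  define Zv where "Zv = \<alpha> Z4"
  define Tv where "Tv = \<alpha> T4"
  obtain j where "dZ Zv * dT Tv - dT Zv * dZ Tv = const4 j"
    unfolding Zv_def Tv_def by (rule jacobian_constant[OF \<alpha> \<alpha>X \<alpha>y])
  then obtain H where H: "dZ H = dX Zv * dZ Tv - dX Tv * dZ Zv" "dT H = dX Zv * dT Tv - dX Tv * dT Zv"
    by (rule hamiltonian)
  note d_simps = derivation_simps[OF d_z_derivation] derivation_simps[OF d_t_derivation]
  have "vx\<^sup>2 dvd \<phi> vz - (vz - 2 * vx * vz * vt)"
    using exp_to_first_order[OF assms(3), of vz] by (simp add: Jac_def poly_h_def d_simps algebra_simps)
  then obtain a where a: "\<phi> vz - (vz - 2 * vx * vz * vt) = vx\<^sup>2 * a" by (rule dvdE)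
  have "vx\<^sup>2 dvd \<phi> vt - (vt + vx * vt\<^sup>2)"
    using exp_to_first_order[OF assms(3), of vt] by (simp add: Jac_def poly_h_def d_simps algebra_simps)
  then obtain b where b: "\<phi> vt - (vt + vx * vt\<^sup>2) = vx\<^sup>2 * b" by (rule dvdE)
  have \<phi>zt: "\<phi> vz = vz - 2 * vx * vz * vt + vx\<^sup>2 * a" "\<phi> vt = vt + vx * vt\<^sup>2 + vx\<^sup>2 * b"
    unfolding a[symmetric] b[symmetric] by simp_all
  have incl2: "incl 2 = 2" by (simp add: incl_def numeral_poly)
  have "poly_P dvd subst_P Zv - incl (\<phi> vz)" unfolding Zv_def sub using cong[of vz] by simp
  then obtain k where "Zv = incl (\<phi> vz) + vy * k" by (rule subst_P_cong_incl)
  then have Zv: "Zv = Z4 - 2 * X4 * Z4 * T4 + X4\<^sup>2 * incl a + vy * k" by (simp add: \<phi>zt incl2)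
  have "poly_P dvd subst_P Tv - incl (\<phi> vt)" unfolding Tv_def sub using cong[of vt] by simp
  then obtain l where "Tv = incl (\<phi> vt) + vy * l" by (rule subst_P_cong_incl)
  then have Tv: "Tv = T4 + X4 * T4\<^sup>2 + X4\<^sup>2 * incl b + vy * l" by (simp add: \<phi>zt)
  have d2: "dX 2 = 0" "dZ 2 = 0" "dT 2 = 0"
    using partials_generators(1,11,16)[of 2] by (simp_all add: incl_def const3_def numeral_poly)
  have HZ: "ev (dZ H) 0 0 z t = - (t\<^sup>2)" and HT: "ev (dT H) 0 0 z t = - 2 * z * t" for z t
    by (simp_all add: H Zv Tv partials_simps d2)
  have "ev H 0 0 0 0 \<noteq> ev H 0 0 (-1) (-1)"
    by (rule hamiltonian_distinct_at_ends) (simp_all add: HZ HT power2_eq_square)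
  moreover have "ev H 0 0 0 0 = ev H 0 0 (-1) (-1)"
  proof (rule hamiltonian_equal_at_ends[OF H])
    interpret comm_ring_hom \<Phi> using \<Phi> by (simp add: alg_automorphism_def)
    \<comment> \<open>\<open>E\<close> represents \<open>\<Phi> (x^2 y) = x^2 \<Phi> y\<close>. On \<open>y = 0\<close>, where \<open>P = r_0\<close>, this gives the vanishing to
      second order in \<open>x\<close>.\<close>
    define E where "E = const4 \<kappa> * vy - Zv * (Zv * Tv\<^sup>2 + 1)"
    have "subst_P E = \<Phi> (poly_P - incl poly_r0)"
      by (simp add: E_def Zv_def Tv_def sub \<Phi>P incl_r0 hom_minus hom_add hom_mult hom_power)
    also have "\<dots> = X4\<^sup>2 * \<Phi> vy" by (simp add: poly_P_def hom_mult hom_power \<Phi>X)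
    finally have "ev (subst_P E) x 0 z t = x\<^sup>2 * ev (\<Phi> vy) x 0 z t" for x z t by simp
    then have E: "ev E x (z * (z * t\<^sup>2 + 1)) z t = x\<^sup>2 * ev (\<Phi> vy) x 0 z t" for x z t
      by (simp add: ev_subst_P)
    fix z t :: complex
    define v where "v = z * (z * t\<^sup>2 + 1)"
    have "ev E 0 v z t = 0" by (simp add: v_def E)
    then show "let v = z * (z * t\<^sup>2 + 1) in
        ev Zv 0 v z t * (ev Zv 0 v z t * (ev Tv 0 v z t)\<^sup>2 + 1) = \<kappa> * v"
      unfolding Let_def v_def[symmetric] by (simp add: E_def)
    have "((\<lambda>x. ev E x v z t) has_field_derivative ev (dX E) 0 v z t) (at 0)"
      by (rule DERIV_cong[OF ev_has_field_derivative[OF DERIV_ident DERIV_const DERIV_const DERIV_const]]) simp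
    moreover have "((\<lambda>x. ev E x v z t) has_field_derivative 0) (at 0)"
      unfolding v_def E
      by (rule DERIV_cong[OF DERIV_mult[OF DERIV_power[OF DERIV_ident]
          ev_has_field_derivative[OF DERIV_ident DERIV_const DERIV_const DERIV_const]]]) simp
    ultimately have "ev (dX E) 0 v z t = 0" by (rule DERIV_unique)
    then show "let v = z * (z * t\<^sup>2 + 1) in
        (2 * ev Zv 0 v z t * (ev Tv 0 v z t)\<^sup>2 + 1) * ev (dX Zv) 0 v z t +
        2 * (ev Zv 0 v z t)\<^sup>2 * ev Tv 0 v z t * ev (dX Tv) 0 v z t = 0"
      unfolding Let_def v_def[symmetric]
      by (simp add: E_def partials_simps algebra_simps power2_eq_square neg_eq_iff_add_eq_0)
  qed
  ultimately show False by blast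
qed

end
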